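(* Let (S) denote the Hamiltonian system $\frac{dx}{dt}=\frac{\partial H}{\partial y}$, $\frac{dy}{dt}=-\frac{\partial H}{\partial x}$, $\frac{dz}{dt}=\frac{\partial H}{\partial w}$, $\frac{dw}{dt}=-\frac{\partial H}{\partial z}$ with polynomial Hamiltonian \begin{align*} H=&\ \tilde H_{VI}(x,y,t;2\alpha_0+\alpha_1,\alpha_1,\alpha_2,\alpha_3+2\alpha_4+\alpha_5,\alpha_3+\alpha_6)\\ &+H_{VI}(z,w,t;2\alpha_0+\alpha_1+2\alpha_2+\alpha_3,\alpha_1+\alpha_3,\alpha_4,\alpha_5,\alpha_6)+\frac{2xz\{(tx-1)y+t\alpha_2\}\{(z-1)w+\alpha_4\}}{t(t-1)}, \end{align*} where $\alpha_0,\dots,\alpha_6\in\mathbb{C}$ satisfy $2\alpha_0+2\alpha_1+2\alpha_2+2\alpha_3+2\alpha_4+\alpha_5+\alpha_6=1$. Then (S) admits extended affine Weyl group symmetry of type $B_6^{(1)}$ as the group of its Bäcklund transformations, whose generators $S_0,\dots,S_6,\varphi$ are given as follows, with $( * )=(x,y,z,w,t;\alpha_0,\dots,\alpha_6)$: \begin{align*} S_0:( * )&\to\Big(\tfrac{tx-1}{t-1},\tfrac{(t-1)y}{t},\tfrac{(t-1)z}{t-z},\tfrac{(t-z)(tw-zw-\alpha_4)}{t(t-1)},1-t;-\alpha_0,\alpha_1+2\alpha_0,\alpha_2,\alpha_3,\alpha_4,\alpha_5,\alpha_6\Big),\\ S_1:( * )&\to\left(x,y-\tfrac{\alpha_1}{x},z,w,t;\alpha_0+\alpha_1,-\alpha_1,\alpha_2+\alpha_1,\alpha_3,\alpha_4,\alpha_5,\alpha_6\right),\\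 S_2:( * )&\to\left(x+\tfrac{\alpha_2}{y},y,z,w,t;\alpha_0,\alpha_1+\alpha_2,-\alpha_2,\alpha_3+\alpha_2,\alpha_4,\alpha_5,\alpha_6\right),\\ S_3:( * )&\to\left(x,y-\tfrac{\alpha_3z}{xz-1},z,w-\tfrac{\alpha_3x}{xz-1},t;\alpha_0,\alpha_1,\alpha_2+\alpha_3,-\alpha_3,\alpha_4+\alpha_3,\alpha_5,\alpha_6\right),\\ S_4:( * )&\to\left(x,y,z+\tfrac{\alpha_4}{w},w,t;\alpha_0,\alpha_1,\alpha_2,\alpha_3+\alpha_4,-\alpha_4,\alpha_5+\alpha_4,\alpha_6+\alpha_4\right),\\ S_5:( * )&\to\left(x,y,z,w-\tfrac{\alpha_5}{z-1},t;\alpha_0,\alpha_1,\alpha_2,\alpha_3,\alpha_4+\alpha_5,-\alpha_5,\alpha_6\right),\\ S_6:( * )&\to\left(x,y,z,w-\tfrac{\alpha_6}{z},t;\alpha_0,\alpha_1,\alpha_2,\alpha_3,\alpha_4+\alpha_6,\alpha_5,-\alpha_6\right),\\ \varphi:( * )&\to\Big(\tfrac{x}{x-1},-(x-1)\{(x-1)y+\alpha_2\},1-z,-w,1-t;\alpha_0,\alpha_1,\alpha_2,\alpha_3,\alpha_4,\alpha_6,\alpha_5\Big). \end{align*}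
   Context: For parameters with $\delta_0+\delta_1+2\delta_2+\delta_3+\delta_4=1$, $$H_{VI}(q,p,t;\delta_0,\dots,\delta_4)=\tfrac{1}{t(t-1)}\big[p^2(q-t)(q-1)q-\{(\delta_0-1)(q-1)q+\delta_3(q-t)q+\delta_4(q-t)(q-1)\}p+\delta_2(\delta_1+\delta_2)q\big],$$ $$\tilde H_{VI}(Q,P,t;\delta_0,\dots,\delta_4)=\tfrac{1}{t(t-1)}\big[P^2(tQ-1)(Q-1)Q-\{(\delta_0-1)t(Q-1)Q+\delta_1(Q-1)(tQ-1)+\delta_3Q(tQ-1)\}P+\delta_2(\delta_2+\delta_4)tQ\big].$$ A Bäcklund transformation is a birational change of $(x,y,z,w,t)$ (depending on the parameters) together with a change of parameters that carries the system with the old parameters into the system with the new parameters (in the new variables, with the new independent variable). Transformations are composed as substitution automorphisms of the field of rational functions in $x,y,z,w,t$ and the parameters. "Extended affine Weyl group symmetry of type $B_6^{(1)}$" means: all the transformations are Bäcklund transformations; $S_i^2=1$ and $(S_iS_j)^{m_{ij}}=1$ with $m_{01}=4$, $m_{12}=m_{23}=m_{34}=m_{45}=m_{46}=3$ and $m_{ij}=2$ for other pairs $i\neq j$ (Dynkin diagram of type $B_6^{(1)}$); and $\varphi$ acts as the diagram automorphism: $\varphi^2=1$ and conjugation by $\varphi$ exchanges $S_5$ and $S_6$ and fixes the other $S_i$. *)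

theory Defs
  imports
    Complex_Main
    "HOL-Library.Poly_Mapping"
    "HOL-Library.Numeral_Type"
    "HOL-Computational_Algebra.Fraction_Field"
begin

section \<open>Fields of rational functions over the complex numbers\<close>

text \<open>A polynomial maps each monomial (an exponent vector) to its coefficient.\<close>

type_synonym 'v cpoly = "('v \<Rightarrow>\<^sub>0 nat) \<Rightarrow>\<^sub>0 complex"
type_synonym 'v ratfun = "'v cpoly fract"

definition const :: "complex \<Rightarrow> 'v::linorder ratfun" where
  "const c = Fract (Poly_Mapping.single 0 c) 1"

definition var :: "'v \<Rightarrow> 'v::linorder ratfun" where
  "var v = Fract (Poly_Mapping.single (Poly_Mapping.single v 1) 1) 1"

definition pderiv_poly :: "'v \<Rightarrow> 'v cpoly \<Rightarrow> 'v cpoly" where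
  "pderiv_poly v p = (\<Sum>m\<in>Poly_Mapping.keys p.
     Poly_Mapping.single (m - Poly_Mapping.single v 1)
       (of_nat (Poly_Mapping.lookup m v) * Poly_Mapping.lookup p m))"

lemma pderiv_poly_superset:
  assumes "finite A" "Poly_Mapping.keys p \<subseteq> A"
  shows "pderiv_poly v p = (\<Sum>m\<in>A. Poly_Mapping.single (m - Poly_Mapping.single v 1)
           (of_nat (Poly_Mapping.lookup m v) * Poly_Mapping.lookup p m))"
  unfolding pderiv_poly_def
  by (rule sum.mono_neutral_left) (use assms in \<open>auto simp: in_keys_iff\<close>)

lemma pderiv_poly_single:
  "pderiv_poly v (Poly_Mapping.single m c) =
     Poly_Mapping.single (m - Poly_Mapping.single v 1) (of_nat (Poly_Mapping.lookup m v) * c)"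
  by (subst pderiv_poly_superset[of "{m}"]) auto

lemma pderiv_poly_0 [simp]: "pderiv_poly v 0 = 0"
  by (simp add: pderiv_poly_def)

lemma pderiv_poly_add: "pderiv_poly v (p + q) = pderiv_poly v p + pderiv_poly v q"
proof -
  let ?A = "Poly_Mapping.keys p \<union> Poly_Mapping.keys q"
  have "Poly_Mapping.keys (p + q) \<subseteq> ?A" by (rule Poly_Mapping.keys_add)
  then show ?thesis
    by (subst (1 2 3) pderiv_poly_superset[of ?A])
       (auto simp: lookup_add sum.distrib ring_distribs single_add)
qed

lemma cpoly_induct [case_names zero single_add]:
  assumes "P (0 :: 'v cpoly)"
    and "\<And>m c p. P p \<Longrightarrow> P (Poly_Mapping.single m c + p)"
  shows "P p"
proof (induction p rule: update_induct)
  case const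
  then show ?case using assms(1) by simp
next
  case (update p m c)
  have "Poly_Mapping.update m c p = Poly_Mapping.single m c + p"
    using update.hyps
    by (intro poly_mapping_eqI) (auto simp: lookup_update lookup_add lookup_single in_keys_iff when_def)
  then show ?case using assms(2)[OF update.IH] by simp
qed

lemma pderiv_poly_mult_single:
  "pderiv_poly v (Poly_Mapping.single m c * Poly_Mapping.single n d) =
     pderiv_poly v (Poly_Mapping.single m c) * Poly_Mapping.single n d +
     Poly_Mapping.single m c * pderiv_poly v (Poly_Mapping.single n d)"
proof -
  let ?s = "Poly_Mapping.single v (1::nat)"
  have *: "m + n - ?s = (m - ?s) + n" if "Poly_Mapping.lookup m v \<noteq> 0" for m n :: "_ \<Rightarrow>\<^sub>0 nat"
    using that by (intro poly_mapping_eqI)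
      (auto simp: lookup_add lookup_minus lookup_single when_def)
  show ?thesis
    using *[of m n] *[of n m]
    by (cases "Poly_Mapping.lookup m v = 0"; cases "Poly_Mapping.lookup n v = 0")
       (simp_all add: mult_single pderiv_poly_single lookup_add single_add[symmetric]
          ring_distribs add.commute mult.assoc mult.left_commute)
qed

lemma pderiv_poly_mult: "pderiv_poly v (p * q) = pderiv_poly v p * q + p * pderiv_poly v q"
proof (induction p rule: cpoly_induct)
  case (single_add m c p)
  have "pderiv_poly v (Poly_Mapping.single m c * q) =
      pderiv_poly v (Poly_Mapping.single m c) * q + Poly_Mapping.single m c * pderiv_poly v q"
  proof (induction q rule: cpoly_induct)
    case (single_add n d q)
    then show ?case by (simp add: ring_distribs pderiv_poly_add pderiv_poly_mult_single)
  qed simp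
  then show ?case using single_add by (simp add: ring_distribs pderiv_poly_add)
qed simp

lift_definition pderiv_rat :: "'v \<Rightarrow> 'v::linorder ratfun \<Rightarrow> 'v ratfun"
  is "\<lambda>v (p, q). (pderiv_poly v p * q - p * pderiv_poly v q, q * q)"
proof (clarsimp, goal_cases)
  case (1 v p q p' q')
  then have e: "p * q' = p' * q" by simp
  have "pderiv_poly v (p * q') = pderiv_poly v (p' * q)"
    by (simp add: e)
  then have d: "pderiv_poly v p * q' = pderiv_poly v p' * q + p' * pderiv_poly v q - p * pderiv_poly v q'"
    by (simp add: pderiv_poly_mult algebra_simps)
  have "(pderiv_poly v p * q - p * pderiv_poly v q) * (q' * q') =
        (pderiv_poly v p * q') * q * q' - (p * q') * pderiv_poly v q * q'"
    by (simp add: algebra_simps)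
  also have "\<dots> = (pderiv_poly v p' * q - p * pderiv_poly v q') * q * q'"
    by (simp only: d e) (simp add: algebra_simps)
  also have "\<dots> = pderiv_poly v p' * q' * q * q - (p * q') * pderiv_poly v q' * q"
    by (simp add: algebra_simps)
  also have "\<dots> = (pderiv_poly v p' * q' - p' * pderiv_poly v q') * (q * q)"
    by (simp only: e) (simp add: algebra_simps)
  finally show ?case .
qed

lemma pderiv_rat_Fract:
  "q \<noteq> 0 \<Longrightarrow> pderiv_rat v (Fract p q) =
     Fract (pderiv_poly v p * q - p * pderiv_poly v q) (q * q)"
  by transfer simp

definition field_aut :: "('v::linorder ratfun \<Rightarrow> 'v ratfun) \<Rightarrow> bool" where
  "field_aut \<sigma> \<longleftrightarrow> bij \<sigma> \<and> (\<forall>f g. \<sigma> (f + g) = \<sigma> f + \<sigma> g) \<and>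
     (\<forall>f g. \<sigma> (f * g) = \<sigma> f * \<sigma> g) \<and> (\<forall>c. \<sigma> (const c) = const c)"


section \<open>The Hamiltonian system\<close>

type_synonym 'a vars = "'a \<times> 'a \<times> 'a \<times> 'a \<times> 'a"
type_synonym 'a params = "'a \<times> 'a \<times> 'a \<times> 'a \<times> 'a \<times> 'a \<times> 'a"

fun map_vars :: "('a \<Rightarrow> 'b) \<Rightarrow> 'a vars \<Rightarrow> 'b vars" where
  "map_vars f (x, y, z, w, t) = (f x, f y, f z, f w, f t)"

fun map_params :: "('a \<Rightarrow> 'b) \<Rightarrow> 'a params \<Rightarrow> 'b params" where
  "map_params f (a0, a1, a2, a3, a4, a5, a6) = (f a0, f a1, f a2, f a3, f a4, f a5, f a6)"

fun normalized :: "'a::field params \<Rightarrow> bool" where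
  "normalized (a0, a1, a2, a3, a4, a5, a6) \<longleftrightarrow>
     2 * a0 + 2 * a1 + 2 * a2 + 2 * a3 + 2 * a4 + a5 + a6 = 1"

definition H_VI :: "'a::field \<Rightarrow> 'a \<Rightarrow> 'a \<Rightarrow> 'a \<Rightarrow> 'a \<Rightarrow> 'a \<Rightarrow> 'a \<Rightarrow> 'a \<Rightarrow> 'a" where
  "H_VI q p t d0 d1 d2 d3 d4 = 1 / (t * (t - 1)) *
     (p^2 * (q - t) * (q - 1) * q
      - ((d0 - 1) * (q - 1) * q + d3 * (q - t) * q + d4 * (q - t) * (q - 1)) * p
      + d2 * (d1 + d2) * q)"

definition H_VI_tilde :: "'a::field \<Rightarrow> 'a \<Rightarrow> 'a \<Rightarrow> 'a \<Rightarrow> 'a \<Rightarrow> 'a \<Rightarrow> 'a \<Rightarrow> 'a \<Rightarrow> 'a" where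
  "H_VI_tilde Q P t d0 d1 d2 d3 d4 = 1 / (t * (t - 1)) *
     (P^2 * (t * Q - 1) * (Q - 1) * Q
      - ((d0 - 1) * t * (Q - 1) * Q + d1 * (Q - 1) * (t * Q - 1) + d3 * Q * (t * Q - 1)) * P
      + d2 * (d2 + d4) * t * Q)"

fun hamiltonian :: "'a::field params \<Rightarrow> 'a vars \<Rightarrow> 'a" where
  "hamiltonian (a0, a1, a2, a3, a4, a5, a6) (x, y, z, w, t) =
     H_VI_tilde x y t (2 * a0 + a1) a1 a2 (a3 + 2 * a4 + a5) (a3 + a6)
     + H_VI z w t (2 * a0 + a1 + 2 * a2 + a3) (a1 + a3) a4 a5 a6
     + 2 * x * z * ((t * x - 1) * y + t * a2) * ((z - 1) * w + a4) / (t * (t - 1))"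

text \<open>For fixed complex parameters we work in the field of rational functions in
  \<open>x, y, z, w, t\<close>, which are the indeterminates numbered 0 to 4.\<close>

type_synonym phase_field = "5 ratfun"

definition phase_vars :: "phase_field vars" where
  "phase_vars = (var 0, var 1, var 2, var 3, var 4)"

definition ham :: "complex params \<Rightarrow> phase_field" where
  "ham a = hamiltonian (map_params const a) phase_vars"

text \<open>The derivative \<open>d/dt\<close> along the solutions of the system with parameters \<open>a\<close>: the
  vector field \<open>dx/dt = \<partial>H/\<partial>y\<close>, \<open>dy/dt = - \<partial>H/\<partial>x\<close>, \<open>dz/dt = \<partial>H/\<partial>w\<close>,
  \<open>dw/dt = - \<partial>H/\<partial>z\<close>, \<open>dt/dt = 1\<close>.\<close>

definition ddt :: "complex params \<Rightarrow> phase_field \<Rightarrow> phase_field" where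
  "ddt a f = pderiv_rat 4 f
     + pderiv_rat 1 (ham a) * pderiv_rat 0 f - pderiv_rat 0 (ham a) * pderiv_rat 1 f
     + pderiv_rat 3 (ham a) * pderiv_rat 2 f - pderiv_rat 2 (ham a) * pderiv_rat 3 f"

text \<open>\<open>F a\<close> is the tuple of new variables as rational functions of the old ones, and \<open>s a\<close>
  the tuple of new parameters. Birationality of the change of variables says that substituting
  \<open>F a\<close> for the variables is an automorphism \<open>\<sigma>\<close> of the field of rational functions; then
  \<open>\<sigma> f\<close> is \<open>f\<close> evaluated at the new variables, so the equations below are the
  system with parameters \<open>s a\<close> in the new variables, with new independent variable \<open>\<sigma> t\<close>.\<close>

definition baecklund ::
  "(complex params \<Rightarrow> phase_field vars) \<Rightarrow> (complex params \<Rightarrow> complex params) \<Rightarrow> bool" where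
  "baecklund F s \<longleftrightarrow> (\<forall>a. normalized a \<longrightarrow> normalized (s a) \<and>
     (\<exists>\<sigma>. field_aut \<sigma> \<and> map_vars \<sigma> phase_vars = F a \<and>
        ddt a (\<sigma> (var 4)) \<noteq> 0 \<and>
        ddt a (\<sigma> (var 0)) / ddt a (\<sigma> (var 4)) = \<sigma> (pderiv_rat 1 (ham (s a))) \<and>
        ddt a (\<sigma> (var 1)) / ddt a (\<sigma> (var 4)) = \<sigma> (- pderiv_rat 0 (ham (s a))) \<and>
        ddt a (\<sigma> (var 2)) / ddt a (\<sigma> (var 4)) = \<sigma> (pderiv_rat 3 (ham (s a))) \<and>
        ddt a (\<sigma> (var 3)) / ddt a (\<sigma> (var 4)) = \<sigma> (- pderiv_rat 2 (ham (s a)))))"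


section \<open>The transformations\<close>

datatype gen = S0 | S1 | S2 | S3 | S4 | S5 | S6 | Phi

fun new_vars :: "gen \<Rightarrow> 'a::field params \<Rightarrow> 'a vars \<Rightarrow> 'a vars" where
  "new_vars S0 (a0, a1, a2, a3, a4, a5, a6) (x, y, z, w, t) =
     ((t * x - 1) / (t - 1), (t - 1) * y / t, (t - 1) * z / (t - z),
      (t - z) * (t * w - z * w - a4) / (t * (t - 1)), 1 - t)"
| "new_vars S1 (a0, a1, a2, a3, a4, a5, a6) (x, y, z, w, t) = (x, y - a1 / x, z, w, t)"
| "new_vars S2 (a0, a1, a2, a3, a4, a5, a6) (x, y, z, w, t) = (x + a2 / y, y, z, w, t)"
| "new_vars S3 (a0, a1, a2, a3, a4, a5, a6) (x, y, z, w, t) =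
     (x, y - a3 * z / (x * z - 1), z, w - a3 * x / (x * z - 1), t)"
| "new_vars S4 (a0, a1, a2, a3, a4, a5, a6) (x, y, z, w, t) = (x, y, z + a4 / w, w, t)"
| "new_vars S5 (a0, a1, a2, a3, a4, a5, a6) (x, y, z, w, t) = (x, y, z, w - a5 / (z - 1), t)"
| "new_vars S6 (a0, a1, a2, a3, a4, a5, a6) (x, y, z, w, t) = (x, y, z, w - a6 / z, t)"
| "new_vars Phi (a0, a1, a2, a3, a4, a5, a6) (x, y, z, w, t) =
     (x / (x - 1), - (x - 1) * ((x - 1) * y + a2), 1 - z, - w, 1 - t)"

fun new_params :: "gen \<Rightarrow> 'a::field params \<Rightarrow> 'a params" where
  "new_params S0 (a0, a1, a2, a3, a4, a5, a6) = (- a0, a1 + 2 * a0, a2, a3, a4, a5, a6)"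
| "new_params S1 (a0, a1, a2, a3, a4, a5, a6) = (a0 + a1, - a1, a2 + a1, a3, a4, a5, a6)"
| "new_params S2 (a0, a1, a2, a3, a4, a5, a6) = (a0, a1 + a2, - a2, a3 + a2, a4, a5, a6)"
| "new_params S3 (a0, a1, a2, a3, a4, a5, a6) = (a0, a1, a2 + a3, - a3, a4 + a3, a5, a6)"
| "new_params S4 (a0, a1, a2, a3, a4, a5, a6) = (a0, a1, a2, a3 + a4, - a4, a5 + a4, a6 + a4)"
| "new_params S5 (a0, a1, a2, a3, a4, a5, a6) = (a0, a1, a2, a3, a4 + a5, - a5, a6)"
| "new_params S6 (a0, a1, a2, a3, a4, a5, a6) = (a0, a1, a2, a3, a4 + a6, a5, - a6)"
| "new_params Phi (a0, a1, a2, a3, a4, a5, a6) = (a0, a1, a2, a3, a4, a6, a5)"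

text \<open>The field of rational functions in \<open>x, y, z, w, t\<close> and the parameters: the linear
  relation between the parameters is solved for the last one, which leaves eleven independent
  indeterminates.\<close>

type_synonym full_field = "11 ratfun"

definition full_vars :: "full_field vars" where
  "full_vars = (var 0, var 1, var 2, var 3, var 4)"

definition full_params :: "full_field params" where
  "full_params = (var 5, var 6, var 7, var 8, var 9, var 10,
     1 - 2 * var 5 - 2 * var 6 - 2 * var 7 - 2 * var 8 - 2 * var 9 - var 10)"

text \<open>This determines \<open>\<sigma>\<close>, because the variables and parameters generate the field.\<close>

definition substitution_aut :: "gen \<Rightarrow> (full_field \<Rightarrow> full_field) \<Rightarrow> bool" where
  "substitution_aut g \<sigma> \<longleftrightarrow> field_aut \<sigma> \<and>
     map_vars \<sigma> full_vars = new_vars g full_params full_vars \<and>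
     map_params \<sigma> full_params = new_params g full_params"

definition reflections :: "gen set" where
  "reflections = {S0, S1, S2, S3, S4, S5, S6}"

definition coxeter_B6 :: "gen \<Rightarrow> gen \<Rightarrow> nat" where
  "coxeter_B6 i j =
     (if {i, j} = {S0, S1} then 4
      else if {i, j} \<in> {{S1, S2}, {S2, S3}, {S3, S4}, {S4, S5}, {S4, S6}} then 3
      else 2)"

definition diagram_aut :: "gen \<Rightarrow> gen" where
  "diagram_aut = id(S5 := S6, S6 := S5)"

end

theory Submission
  imports Defs
begin

text \<open>
  Write \<open>H = K / (t (t - 1))\<close> with \<open>K\<close> polynomial. Under each generator \<open>K\<close>, taken at the
  new parameters and new variables, is \<open>\<plusminus>(K + c)\<close>, where \<open>c\<close> depends on \<open>t\<close> alone except for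
  \<open>S\<^sub>0\<close>. There \<open>c / (t (t - 1))\<close> is a Hamiltonian for the explicit \<open>t\<close>-dependence of the new
  variables. As every generator preserves the Poisson bracket, this identity yields the
  transformed Hamiltonian system. A substitution with rational inverse extends to the field
  because a polynomial that it kills is recovered from its image by the inverse substitution.
  The relations then become identities between points over a field; the denominators that occur
  are nonzero because the automorphisms are injective.
\<close>

section \<open>Evaluation and substitution of rational functions\<close>

text \<open>Rational functions have poles, so evaluating them is a partial operation, and it is
  needed for two purposes: to substitute rational functions for the indeterminates, and to see that
  a denominator is not the zero function. The single relation \<open>evals_to\<close> serves both,
  with rational functions or complex numbers as values. The inverse that a substitution needs comes
  from the relations themselves. Each generator is an involution on pairs of parameters and
  variables, so at fixed parameters its inverse is the same formula at the transformed parameters.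
  Compositions of automorphisms are never expanded inside the field. The formulas make sense over
  every field and commute with homomorphisms, and a homomorphism is determined by the image of the
  generic point; hence a relation in the group is one equation between two images of that
  point.\<close>

definition monom_eval :: "('v \<Rightarrow> 'b::comm_semiring_1) \<Rightarrow> ('v \<Rightarrow>\<^sub>0 nat) \<Rightarrow> 'b" where
  "monom_eval h m = (\<Prod>v\<in>Poly_Mapping.keys m. h v ^ Poly_Mapping.lookup m v)"

lemma monom_eval_superset:
  assumes "finite A" "Poly_Mapping.keys m \<subseteq> A"
  shows "monom_eval h m = (\<Prod>v\<in>A. h v ^ Poly_Mapping.lookup m v)"
  unfolding monom_eval_def
  by (rule prod.mono_neutral_left) (use assms in \<open>auto simp: in_keys_iff\<close>)

lemma monom_eval_add: "monom_eval h (m + n) = monom_eval h m * monom_eval h n"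
proof -
  let ?A = "Poly_Mapping.keys m \<union> Poly_Mapping.keys n"
  have "Poly_Mapping.keys (m + n) \<subseteq> ?A" by (rule Poly_Mapping.keys_add)
  then show ?thesis
    by (simp add: monom_eval_superset[of ?A] lookup_add power_add prod.distrib)
qed

lemma monom_eval_simps [simp]: "monom_eval h 0 = 1" "monom_eval h (Poly_Mapping.single v (Suc 0)) = h v"
  by (simp_all add: monom_eval_def)

lemma const_0: "const 0 = 0" and const_1 [simp]: "const 1 = 1"
  by (simp_all add: const_def Zero_fract_def One_fract_def)

lemma const_add: "const (a + b) = const a + const b"
  by (simp add: const_def single_add)

lemma const_mult: "const (a * b) = const a * const b"
  by (simp add: const_def mult_single)

lemma const_minus: "const (- a) = - const a"
  using const_add[of a "- a"] by (simp add: const_0 eq_neg_iff_add_eq_0 add.commute)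

lemma const_diff: "const (a - b) = const a - const b"
  using const_add[of a "- b"] by (simp add: const_minus)

lemma const_numeral [simp]: "const (numeral n) = numeral n"
proof -
  have "const (of_nat k) = of_nat k" for k by (induction k) (simp_all add: const_0 const_add)
  from this[of "numeral n"] show ?thesis by simp
qed

text \<open>The coefficients pass through a ring homomorphism \<open>c\<close>, so that
  \<open>c = id\<close> gives values at complex points and \<open>c = const\<close> gives
  substitution of rational functions.\<close>

locale evaluation =
  fixes c :: "complex \<Rightarrow> 'b::field" and h :: "'v::linorder \<Rightarrow> 'b"
  assumes c_1 [simp]: "c 1 = 1" and c_add: "c (a + b) = c a + c b" and c_mult: "c (a * b) = c a * c b"
begin

lemma c_0 [simp]: "c 0 = 0"
  using c_add[of 0 0] by (metis add_0 add_cancel_right_left)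

definition poly_eval :: "'v cpoly \<Rightarrow> 'b" where
  "poly_eval p = (\<Sum>m\<in>Poly_Mapping.keys p. c (Poly_Mapping.lookup p m) * monom_eval h m)"

lemma poly_eval_superset:
  assumes "finite A" "Poly_Mapping.keys p \<subseteq> A"
  shows "poly_eval p = (\<Sum>m\<in>A. c (Poly_Mapping.lookup p m) * monom_eval h m)"
  unfolding poly_eval_def
  by (rule sum.mono_neutral_left) (use assms in \<open>auto simp: in_keys_iff\<close>)

lemma poly_eval_0 [simp]: "poly_eval 0 = 0"
  by (simp add: poly_eval_def)

lemma poly_eval_single: "poly_eval (Poly_Mapping.single m a) = c a * monom_eval h m"
  by (subst poly_eval_superset[of "{m}"]) auto

lemma poly_eval_1 [simp]: "poly_eval 1 = 1"
  by (simp only: single_one[symmetric] poly_eval_single) simp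

lemma poly_eval_add: "poly_eval (p + q) = poly_eval p + poly_eval q"
proof -
  let ?A = "Poly_Mapping.keys p \<union> Poly_Mapping.keys q"
  have "Poly_Mapping.keys (p + q) \<subseteq> ?A" by (rule Poly_Mapping.keys_add)
  then show ?thesis
    by (simp add: poly_eval_superset[of ?A] lookup_add c_add ring_distribs sum.distrib)
qed

lemma poly_eval_mult: "poly_eval (p * q) = poly_eval p * poly_eval q"
proof (induction p rule: cpoly_induct)
  case (single_add m a p)
  have "poly_eval (Poly_Mapping.single m a * q) = poly_eval (Poly_Mapping.single m a) * poly_eval q"
  proof (induction q rule: cpoly_induct)
    case (single_add n b q)
    then show ?case
      by (simp add: ring_distribs poly_eval_add mult_single poly_eval_single c_mult monom_eval_add)
  qed simp
  then show ?case using single_add by (simp add: ring_distribs poly_eval_add)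
qed simp

text \<open>A relation, since a value is undefined at a pole. Any fraction whose denominator
  survives may witness it; cross-multiplication makes the value independent of the choice.\<close>

definition evals_to :: "'v ratfun \<Rightarrow> 'b \<Rightarrow> bool" where
  "evals_to f r \<longleftrightarrow> (\<exists>p q. poly_eval q \<noteq> 0 \<and> f = Fract p q \<and> r = poly_eval p / poly_eval q)"

lemma evals_toI: "poly_eval q \<noteq> 0 \<Longrightarrow> r = poly_eval p / poly_eval q \<Longrightarrow> evals_to (Fract p q) r"
  unfolding evals_to_def by blast

lemma evals_toE:
  assumes "evals_to f r"
  obtains p q where "q \<noteq> 0" "poly_eval q \<noteq> 0" "f = Fract p q" "r = poly_eval p / poly_eval q"
  using assms poly_eval_0 unfolding evals_to_def by metis

lemma evals_to_unique: "evals_to f r \<Longrightarrow> evals_to f s \<Longrightarrow> r = s"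
proof (elim evals_toE)
  fix p q p' q'
  assume q: "q \<noteq> 0" "q' \<noteq> 0" "poly_eval q \<noteq> 0" "poly_eval q' \<noteq> 0" and f: "f = Fract p q" "f = Fract p' q'"
    and r: "r = poly_eval p / poly_eval q" "s = poly_eval p' / poly_eval q'"
  have "p * q' = p' * q" using f q by (simp add: eq_fract)
  then have "poly_eval p * poly_eval q' = poly_eval p' * poly_eval q"
    by (metis poly_eval_mult)
  then show "r = s" using q r by (simp add: frac_eq_eq)
qed

lemma evals_to_const: "evals_to (const a) (c a)"
  unfolding const_def by (rule evals_toI) (simp_all add: poly_eval_single)

lemma evals_to_var: "evals_to (var v) (h v)"
  unfolding var_def by (rule evals_toI) (simp_all add: poly_eval_single)

lemma evals_to_add: "evals_to f r \<Longrightarrow> evals_to g s \<Longrightarrow> evals_to (f + g) (r + s)"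
  by (elim evals_toE)
    (auto intro!: evals_toI simp: poly_eval_mult poly_eval_add add_frac_eq)

lemma evals_to_mult: "evals_to f r \<Longrightarrow> evals_to g s \<Longrightarrow> evals_to (f * g) (r * s)"
  by (elim evals_toE) (auto intro!: evals_toI simp: poly_eval_mult)

lemma evals_to_0: "evals_to 0 0" and evals_to_1: "evals_to 1 1"
  using evals_to_const[of 0] evals_to_const[of 1] by (simp_all add: const_0)

lemma evals_to_uminus: "evals_to f r \<Longrightarrow> evals_to (- f) (- r)"
proof -
  have "c (- 1) = - 1" using c_add[of 1 "- 1"] by (simp add: eq_neg_iff_add_eq_0 add.commute)
  then have "evals_to (- 1) (- 1)" using evals_to_const[of "- 1"] by (simp add: const_minus)
  then show "evals_to f r \<Longrightarrow> evals_to (- f) (- r)" using evals_to_mult by fastforce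
qed

lemma evals_to_diff: "evals_to f r \<Longrightarrow> evals_to g s \<Longrightarrow> evals_to (f - g) (r - s)"
  using evals_to_add[OF _ evals_to_uminus, of f r g s] by simp

lemma evals_to_inverse: "evals_to f r \<Longrightarrow> r \<noteq> 0 \<Longrightarrow> evals_to (inverse f) (inverse r)"
  by (elim evals_toE) (auto intro!: evals_toI simp del: inverse_eq_divide)

lemma evals_to_divide: "evals_to f r \<Longrightarrow> evals_to g s \<Longrightarrow> s \<noteq> 0 \<Longrightarrow> evals_to (f / g) (r / s)"
  using evals_to_mult[OF _ evals_to_inverse] by (simp add: divide_inverse)

lemma evals_to_numeral: "evals_to (numeral n) (numeral n)"
proof -
  have "c (of_nat k) = of_nat k" for k by (induction k) (simp_all add: c_add)
  from this[of "numeral n"] show ?thesis using evals_to_const[of "numeral n"] by simp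
qed

lemmas evals_to_intros = evals_to_const evals_to_var evals_to_add evals_to_mult evals_to_0 evals_to_1
  evals_to_uminus evals_to_diff evals_to_divide evals_to_numeral

text \<open>Used to show that a rational function is nonzero by its value at one convenient
  point.\<close>

lemma nonzero_if_evals_to: "evals_to f r \<Longrightarrow> r \<noteq> 0 \<Longrightarrow> f \<noteq> 0"
  using evals_to_unique[OF _ evals_to_0] by blast

end

section \<open>Homomorphisms between fields of rational functions\<close>

definition ratfun_hom :: "('v::linorder ratfun \<Rightarrow> 'w::linorder ratfun) \<Rightarrow> bool" where
  "ratfun_hom \<sigma> \<longleftrightarrow> (\<forall>f g. \<sigma> (f + g) = \<sigma> f + \<sigma> g) \<and> (\<forall>f g. \<sigma> (f * g) = \<sigma> f * \<sigma> g) \<and>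
     (\<forall>c. \<sigma> (const c) = const c)"

text \<open>A homomorphism of fields is injective, and for \<open>g = 0\<close> both sides of the
  quotient rule are 0 because division by zero gives 0. The rule can thus rewrite without side
  conditions.\<close>

lemma ratfun_hom_simps:
  assumes "ratfun_hom \<sigma>"
  shows "\<sigma> (f + g) = \<sigma> f + \<sigma> g" "\<sigma> (f * g) = \<sigma> f * \<sigma> g" "\<sigma> (const c) = const c"
    "\<sigma> 0 = 0" "\<sigma> 1 = 1" "\<sigma> (- f) = - \<sigma> f" "\<sigma> (f - g) = \<sigma> f - \<sigma> g" "\<sigma> (f / g) = \<sigma> f / \<sigma> g"
    "\<sigma> (numeral n) = numeral n" "\<sigma> f = 0 \<longleftrightarrow> f = 0"
proof -
  show add: "\<sigma> (f + g) = \<sigma> f + \<sigma> g" and mult: "\<sigma> (f * g) = \<sigma> f * \<sigma> g" and const: "\<sigma> (const c) = const c"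
    for f g c using assms unfolding ratfun_hom_def by blast+
  show 0: "\<sigma> 0 = 0" and 1: "\<sigma> 1 = 1" and "\<sigma> (numeral n) = numeral n"
    using const[of 0] const[of 1] const[of "numeral n"] by (simp_all add: const_0)
  show uminus: "\<sigma> (- f) = - \<sigma> f" for f
    using add[of f "- f"] by (simp add: 0 eq_neg_iff_add_eq_0 add.commute)
  show "\<sigma> (f - g) = \<sigma> f - \<sigma> g"
    using add[of f "- g"] by (simp add: uminus)
  show eq0: "\<sigma> f = 0 \<longleftrightarrow> f = 0" for f
    using mult[of f "inverse f"] 0 1 by (cases "f = 0") auto
  show "\<sigma> (f / g) = \<sigma> f / \<sigma> g"
  proof (cases "g = 0")
    case False
    then have "\<sigma> (f / g) * \<sigma> g = \<sigma> f" by (simp flip: mult)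
    then show ?thesis using False eq0 by (simp add: nonzero_eq_divide_eq)
  qed (simp add: 0)
qed

lemma poly_mapping_eq_sum:
  "m = (\<Sum>v\<in>Poly_Mapping.keys m. Poly_Mapping.single v (Poly_Mapping.lookup m v))"
proof (rule poly_mapping_eqI)
  fix k
  have "(\<Sum>v\<in>Poly_Mapping.keys m. Poly_Mapping.lookup m v when v = k) = Poly_Mapping.lookup m k"
    by (simp add: when_def in_keys_iff)
  then show "Poly_Mapping.lookup m k =
      Poly_Mapping.lookup (\<Sum>v\<in>Poly_Mapping.keys m. Poly_Mapping.single v (Poly_Mapping.lookup m v)) k"
    by (simp add: lookup_sum lookup_single)
qed

text \<open>Puts the step of \<open>cpoly_induct\<close> into terms of \<open>const\<close>,
  \<open>var\<close> and field operations, on which homomorphisms and evaluations are known.\<close>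

lemma Fract_single_eq: "Fract (Poly_Mapping.single m c + p) 1 =
    const c * (\<Prod>v\<in>Poly_Mapping.keys m. var v ^ Poly_Mapping.lookup m v) + Fract p 1"
proof -
  have pw: "var v ^ n = Fract (Poly_Mapping.single (Poly_Mapping.single v n) 1) 1" for v :: 'a and n
    by (induction n) (simp_all add: var_def mult_single One_fract_def flip: single_add)
  have "(\<Prod>v\<in>A. var v ^ f v) = Fract (Poly_Mapping.single (\<Sum>v\<in>A. Poly_Mapping.single v (f v)) 1) 1"
    if "finite A" for A :: "'a set" and f
    using that by (induction rule: finite_induct) (simp_all add: pw mult_single One_fract_def)
  from this[of "Poly_Mapping.keys m" "Poly_Mapping.lookup m"]
  have "(\<Prod>v\<in>Poly_Mapping.keys m. var v ^ Poly_Mapping.lookup m v) = Fract (Poly_Mapping.single m 1) 1"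
    by (simp add: poly_mapping_eq_sum[symmetric])
  then show ?thesis by (simp add: const_def mult_single)
qed

text \<open>The division case supplies \<open>g \<noteq> 0\<close>; together with injectivity of a
  homomorphism this is what evaluating a quotient requires.\<close>

lemma ratfun_induct [case_names const var add mult divide]:
  assumes const: "\<And>c. P (const c)" and var: "\<And>v. P (var v)"
    and add: "\<And>f g. P f \<Longrightarrow> P g \<Longrightarrow> P (f + g)" and mult: "\<And>f g. P f \<Longrightarrow> P g \<Longrightarrow> P (f * g)"
    and divide: "\<And>f g. P f \<Longrightarrow> P g \<Longrightarrow> g \<noteq> 0 \<Longrightarrow> P (f / g)"
  shows "P (f :: 'v::linorder ratfun)"
proof -
  have power: "P f \<Longrightarrow> P (f ^ n)" for f n
    using const[of 1] by (induction n) (auto intro: mult)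
  have prod: "(\<And>v. v \<in> A \<Longrightarrow> P (f v)) \<Longrightarrow> P (\<Prod>v\<in>A. f v)" if "finite A" for A and f :: "'v \<Rightarrow> _"
    using that const[of 1] by (induction A rule: finite_induct) (auto intro: mult)
  have poly: "P (Fract p 1)" for p
  proof (induction p rule: cpoly_induct)
    case zero
    show ?case using const[of 0] by (simp add: const_0 Zero_fract_def)
  next
    case (single_add m c p)
    show ?case unfolding Fract_single_eq
      by (intro add mult const prod power var single_add) simp
  qed
  show ?thesis
  proof (cases f)
    case (Fract p q)
    then show ?thesis
      using divide[OF poly poly, of q p] by (simp add: Zero_fract_def eq_fract)
  qed
qed

lemma ratfun_hom_eqI:
  assumes "ratfun_hom \<sigma>" "ratfun_hom \<tau>" "\<And>v. \<sigma> (var v) = \<tau> (var v)"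
  shows "\<sigma> = \<tau>"
proof
  fix f show "\<sigma> f = \<tau> f"
    by (induction f rule: ratfun_induct) (simp_all add: assms ratfun_hom_simps)
qed

lemma evaluation_const: "evaluation const"
  by unfold_locales (simp_all add: const_add const_mult)

lemma evaluation_id: "evaluation id"
  by unfold_locales simp_all

text \<open>The substitution of \<open>F\<close> is injective on polynomials, because evaluation at \<open>G\<close> recovers
  the polynomial; hence it extends to all fractions.\<close>

lemma inverse_substitution:
  fixes F :: "'v::linorder \<Rightarrow> 'w::linorder ratfun" and G :: "'w \<Rightarrow> 'v ratfun"
  assumes "\<And>v. evaluation.evals_to const G (F v) (var v)"
  shows "\<exists>\<sigma>. ratfun_hom \<sigma> \<and> (\<forall>v. \<sigma> (var v) = F v)"
proof -
  interpret F: evaluation const F by (rule evaluation_const)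
  interpret G: evaluation const G by (rule evaluation_const)
  have inv: "G.evals_to (F.poly_eval p) (Fract p 1)" for p
  proof (induction p rule: cpoly_induct)
    case zero
    show ?case using G.evals_to_0 by (simp add: Zero_fract_def)
  next
    case (single_add m c p)
    have power: "G.evals_to f r \<Longrightarrow> G.evals_to (f ^ n) (r ^ n)" for f r n
      by (induction n) (auto intro: G.evals_to_intros)
    have prod: "G.evals_to (\<Prod>v\<in>A. F v ^ n v) (\<Prod>v\<in>A. var v ^ n v)" if "finite A" for A and n :: "'v \<Rightarrow> nat"
      using that by (induction A rule: finite_induct) (auto intro: G.evals_to_intros power assms)
    show ?case unfolding Fract_single_eq F.poly_eval_add F.poly_eval_single monom_eval_def
      by (intro G.evals_to_intros prod single_add) simp
  qed
  have inj: "F.poly_eval p \<noteq> 0" if "p \<noteq> 0" for p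
  proof
    assume "F.poly_eval p = 0"
    then have "Fract p 1 = 0"
      using G.evals_to_unique[OF inv[of p]] G.evals_to_0 by metis
    then show False using that by (simp add: Zero_fract_def eq_fract)
  qed
  define \<sigma> where "\<sigma> f = (THE r. F.evals_to f r)" for f
  have ex: "\<exists>r. F.evals_to f r" for f
  proof (cases f)
    case (Fract p q)
    then show ?thesis unfolding F.evals_to_def using inj by blast
  qed
  have eq: "\<sigma> f = r" if "F.evals_to f r" for f r
    unfolding \<sigma>_def using that F.evals_to_unique by blast
  then have \<sigma>: "F.evals_to f (\<sigma> f)" for f
    using ex[of f] by auto
  have "ratfun_hom \<sigma>"
    unfolding ratfun_hom_def by (auto intro!: eq F.evals_to_intros \<sigma>)
  moreover have "\<sigma> (var v) = F v" for v
    by (rule eq[OF F.evals_to_var])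
  ultimately show ?thesis by blast
qed

lemma birational_field_aut:
  assumes "\<And>v. evaluation.evals_to const G (F v) (var v)" "\<And>v. evaluation.evals_to const F (G v) (var v)"
  shows "\<exists>\<sigma>. field_aut \<sigma> \<and> (\<forall>v. \<sigma> (var v) = F v)"
proof -
  interpret F: evaluation const F by (rule evaluation_const)
  interpret G: evaluation const G by (rule evaluation_const)
  obtain \<sigma> \<tau> where \<sigma>: "ratfun_hom \<sigma>" "\<And>v. \<sigma> (var v) = F v" and \<tau>: "ratfun_hom \<tau>" "\<And>v. \<tau> (var v) = G v"
    using inverse_substitution[OF assms(1)] inverse_substitution[OF assms(2)] by blast
  \<comment> \<open>Ties the homomorphism to \<open>evals_to\<close>, whose uniqueness then turns
    the two hypotheses into \<open>\<sigma> (G v) = var v\<close> and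
    \<open>\<tau> (F v) = var v\<close>.\<close>
  have F: "F.evals_to f (\<sigma> f)" for f
  proof (induction f rule: ratfun_induct)
    case (divide f g)
    then show ?case by (simp add: ratfun_hom_simps \<sigma>(1) F.evals_to_divide)
  qed (simp_all add: ratfun_hom_simps \<sigma> F.evals_to_intros)
  have G: "G.evals_to f (\<tau> f)" for f
  proof (induction f rule: ratfun_induct)
    case (divide f g)
    then show ?case by (simp add: ratfun_hom_simps \<tau>(1) G.evals_to_divide)
  qed (simp_all add: ratfun_hom_simps \<tau> G.evals_to_intros)
  have "\<sigma> (G v) = var v" "\<tau> (F v) = var v" for v
    using F.evals_to_unique[OF F assms(2)] G.evals_to_unique[OF G assms(1)] by auto
  moreover have "ratfun_hom (\<sigma> \<circ> \<tau>)" "ratfun_hom (\<tau> \<circ> \<sigma>)" "ratfun_hom id"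
    using \<sigma>(1) \<tau>(1) by (simp_all add: ratfun_hom_def)
  ultimately have "\<sigma> \<circ> \<tau> = id" "\<tau> \<circ> \<sigma> = id"
    by (auto intro!: ratfun_hom_eqI simp: \<sigma>(2) \<tau>(2))
  then have "bij \<sigma>" by (metis o_bij)
  then show ?thesis using \<sigma> unfolding field_aut_def ratfun_hom_def by blast
qed

lemma ratfun_hom_if_field_aut: "field_aut \<sigma> \<Longrightarrow> ratfun_hom \<sigma>"
  by (simp add: field_aut_def ratfun_hom_def)

section \<open>Derivations and the Poisson bracket\<close>

text \<open>Derivations along a homomorphism \<open>\<sigma>\<close>. Bracketing after applying
  \<open>\<sigma>\<close> and applying \<open>\<sigma>\<close> after bracketing are both of this
  kind, so they can be compared on the indeterminates; the identity gives ordinary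
  derivations.\<close>

definition twisted_derivation :: "('v::linorder ratfun \<Rightarrow> 'v ratfun) \<Rightarrow> ('v ratfun \<Rightarrow> 'v ratfun) \<Rightarrow> bool" where
  "twisted_derivation \<sigma> D \<longleftrightarrow> (\<forall>f g. D (f + g) = D f + D g) \<and>
     (\<forall>f g. D (f * g) = D f * \<sigma> g + \<sigma> f * D g) \<and> (\<forall>c. D (const c) = 0)"

lemma twisted_derivation_simps:
  assumes "ratfun_hom \<sigma>" "twisted_derivation \<sigma> D"
  shows "D (f + g) = D f + D g" "D (f * g) = D f * \<sigma> g + \<sigma> f * D g" "D (const c) = 0"
    "D 0 = 0" "D 1 = 0" "D (numeral n) = 0" "D (- f) = - D f" "D (f - g) = D f - D g"
    "D (f / g) = (D f * \<sigma> g - \<sigma> f * D g) / (\<sigma> g * \<sigma> g)"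
proof -
  show add: "D (f + g) = D f + D g" and mult: "D (f * g) = D f * \<sigma> g + \<sigma> f * D g"
    and const: "D (const c) = 0" for f g c
    using assms(2) unfolding twisted_derivation_def by blast+
  show 0: "D 0 = 0" and "D 1 = 0" "D (numeral n) = 0"
    using const[of 0] const[of 1] const[of "numeral n"] by (simp_all add: const_0)
  show uminus: "D (- f) = - D f" for f
    using add[of f "- f"] by (simp add: 0 eq_neg_iff_add_eq_0 add.commute)
  show "D (f - g) = D f - D g"
    using add[of f "- g"] by (simp add: uminus)
  show "D (f / g) = (D f * \<sigma> g - \<sigma> f * D g) / (\<sigma> g * \<sigma> g)"
  proof (cases "g = 0")
    case False
    then have nz: "\<sigma> g \<noteq> 0" by (simp add: ratfun_hom_simps[OF assms(1)])
    have "D f = D (f / g) * \<sigma> g + \<sigma> (f / g) * D g"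
      using mult[of "f / g" g] False by simp
    then show ?thesis using nz by (simp add: ratfun_hom_simps[OF assms(1)] field_simps)
  qed (simp add: 0 ratfun_hom_simps[OF assms(1)])
qed

lemma twisted_derivation_eqI:
  assumes "ratfun_hom \<sigma>" "twisted_derivation \<sigma> D" "twisted_derivation \<sigma> E"
    and "\<And>v. D (var v) = E (var v)"
  shows "D f = E f"
  by (induction f rule: ratfun_induct)
    (simp_all add: assms(4) twisted_derivation_simps[OF assms(1,2)] twisted_derivation_simps[OF assms(1,3)])

lemma ratfun_hom_ident: "ratfun_hom (\<lambda>f. f)"
  by (simp add: ratfun_hom_def)

lemma derivation_pderiv_rat: "twisted_derivation (\<lambda>f. f) (pderiv_rat v)"
  unfolding twisted_derivation_def
proof (intro conjI allI)
  fix f g :: "'a ratfun"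
  obtain p q where f: "f = Fract p q" "q \<noteq> 0" by (cases f)
  obtain r s where g: "g = Fract r s" "s \<noteq> 0" by (cases g)
  show "pderiv_rat v (f + g) = pderiv_rat v f + pderiv_rat v g"
    using f(2) g(2)
    by (simp add: f g pderiv_rat_Fract pderiv_poly_mult pderiv_poly_add eq_fract algebra_simps)
  show "pderiv_rat v (f * g) = pderiv_rat v f * g + f * pderiv_rat v g"
    using f(2) g(2)
    by (simp add: f g pderiv_rat_Fract pderiv_poly_mult pderiv_poly_add eq_fract algebra_simps)
next
  fix c
  have "pderiv_poly v 1 = 0"
    by (simp only: single_one[symmetric] pderiv_poly_single) simp
  then show "pderiv_rat v (const c) = 0"
    by (simp add: const_def pderiv_rat_Fract pderiv_poly_single Zero_fract_def)
qed

lemma pderiv_rat_var: "pderiv_rat v (var u) = (if u = v then 1 else 0)"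
proof -
  have "pderiv_poly v 1 = 0"
    by (simp only: single_one[symmetric] pderiv_poly_single) simp
  then show ?thesis
    by (auto simp: var_def pderiv_rat_Fract pderiv_poly_single Zero_fract_def One_fract_def lookup_single)
qed

lemmas pderiv_rat_simps = twisted_derivation_simps[OF ratfun_hom_ident derivation_pderiv_rat] pderiv_rat_var

text \<open>The canonical bracket, in which \<open>x, y\<close> and \<open>z, w\<close> are
  conjugate pairs and \<open>t\<close> is central; explicit time dependence is therefore seen only
  by \<open>pderiv_rat 4\<close>.\<close>

definition pbracket :: "phase_field \<Rightarrow> phase_field \<Rightarrow> phase_field" where
  "pbracket f g = pderiv_rat 0 f * pderiv_rat 1 g - pderiv_rat 1 f * pderiv_rat 0 g +
     pderiv_rat 2 f * pderiv_rat 3 g - pderiv_rat 3 f * pderiv_rat 2 g"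

lemma ddt_eq: "ddt a f = pderiv_rat 4 f + pbracket f (ham a)"
  by (simp add: ddt_def pbracket_def algebra_simps)

lemma pbracket_self: "pbracket f f = 0" and pbracket_swap: "pbracket g f = - pbracket f g"
  by (simp_all add: pbracket_def)

lemma pbracket_add: "pbracket f (g + h) = pbracket f g + pbracket f h"
  by (simp add: pbracket_def pderiv_rat_simps algebra_simps)

lemma pbracket_derivation:
  "pbracket (f + g) k = pbracket f k + pbracket g k"
  "pbracket (f * g) k = pbracket f k * g + f * pbracket g k"
  "pbracket (const c) k = 0"
  unfolding pbracket_def pderiv_rat_simps by algebra+

lemma forall_5: "(\<forall>i :: 5. P i) \<longleftrightarrow> P 0 \<and> P 1 \<and> P 2 \<and> P 3 \<and> P 4"
proof (intro iffI allI)
  fix i :: 5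
  assume P: "P 0 \<and> P 1 \<and> P 2 \<and> P 3 \<and> P 4"
  show "P i"
  proof (cases i)
    case (of_int z)
    then have "z \<in> {0, 1, 2, 3, 4}" by auto
    then show ?thesis using P of_int by auto
  qed
qed simp

text \<open>Both sides are twisted derivations in each argument. With a variable as second argument
  the hypothesis extends to all \<open>f\<close>; with that \<open>f\<close> fixed it extends to all
  \<open>g\<close>.\<close>

lemma pbracket_hom:
  assumes \<sigma>: "ratfun_hom \<sigma>"
    and gen: "\<And>i j. pbracket (\<sigma> (var i)) (\<sigma> (var j)) = \<sigma> (pbracket (var i) (var j))"
  shows "pbracket (\<sigma> f) (\<sigma> g) = \<sigma> (pbracket f g)"
proof -
  note h = ratfun_hom_simps[OF \<sigma>]
  have L: "twisted_derivation \<sigma> (\<lambda>f. pbracket (\<sigma> f) (\<sigma> g))" "twisted_derivation \<sigma> (\<lambda>f. \<sigma> (pbracket f g))" for g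
    unfolding twisted_derivation_def
    by (simp_all add: h pbracket_derivation)
  have R: "twisted_derivation \<sigma> (\<lambda>g. pbracket (\<sigma> f) (\<sigma> g))" "twisted_derivation \<sigma> (\<lambda>g. \<sigma> (pbracket f g))" for f
    unfolding twisted_derivation_def
    by (simp_all add: h pbracket_derivation pbracket_swap[of "\<sigma> f"] pbracket_swap[of f])
  have gen': "pbracket (\<sigma> f) (\<sigma> (var j)) = \<sigma> (pbracket f (var j))" for f j
    by (rule twisted_derivation_eqI[OF \<sigma> L]) (rule gen)
  show ?thesis
    by (rule twisted_derivation_eqI[OF \<sigma> R]) (rule gen')
qed

text \<open>Since \<open>\<sigma>\<close> preserves the bracket, \<open>\<sigma>\<close> of the
  bracket of \<open>f\<close> with \<open>ham b\<close> is \<open>e\<close> times the bracket of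
  \<open>\<sigma> f\<close> with \<open>ham a + G\<close>. The part from \<open>G\<close> equals the
  explicit \<open>t\<close>-derivative of \<open>\<sigma> f\<close>, so the result is
  \<open>e * ddt a (\<sigma> f)\<close>. As \<open>e\<close> is the derivative of the new time and
  \<open>e * e = 1\<close>, multiplying by \<open>e\<close> is dividing by it.\<close>

lemma baecklund_criterion:
  assumes \<sigma>: "ratfun_hom \<sigma>" and XYZW: "map_vars \<sigma> phase_vars = (X, Y, Z, W, T)"
    and symp: "pbracket X Y = 1" "pbracket X Z = 0" "pbracket X W = 0" "pbracket Y Z = 0" "pbracket Y W = 0"
      "pbracket Z W = 1"
    and T: "T = var 4 \<and> e = 1 \<or> T = 1 - var 4 \<and> e = - 1"
    and H: "\<sigma> (ham b) = e * (ham a + G)"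
    and G: "pbracket X G = pderiv_rat 4 X" "pbracket Y G = pderiv_rat 4 Y"
      "pbracket Z G = pderiv_rat 4 Z" "pbracket W G = pderiv_rat 4 W"
  shows "ddt a (\<sigma> (var 4)) \<noteq> 0 \<and>
        ddt a (\<sigma> (var 0)) / ddt a (\<sigma> (var 4)) = \<sigma> (pderiv_rat 1 (ham b)) \<and>
        ddt a (\<sigma> (var 1)) / ddt a (\<sigma> (var 4)) = \<sigma> (- pderiv_rat 0 (ham b)) \<and>
        ddt a (\<sigma> (var 2)) / ddt a (\<sigma> (var 4)) = \<sigma> (pderiv_rat 3 (ham b)) \<and>
        ddt a (\<sigma> (var 3)) / ddt a (\<sigma> (var 4)) = \<sigma> (- pderiv_rat 2 (ham b))"
proof -
  note h = ratfun_hom_simps[OF \<sigma>]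
  have v: "\<sigma> (var 0) = X" "\<sigma> (var 1) = Y" "\<sigma> (var 2) = Z" "\<sigma> (var 3) = W" "\<sigma> (var 4) = T"
    using XYZW by (simp_all add: phase_vars_def)
  have T0: "pbracket T f = 0" "pbracket f T = 0" for f
    using T by (auto simp: pbracket_def pderiv_rat_simps)
  have e: "ddt a T = e" "e * e = 1" "e \<noteq> 0"
    using T by (auto simp: ddt_eq T0 pderiv_rat_simps)
  have swapped: "pbracket Y X = - 1" "pbracket Z X = 0" "pbracket W X = 0" "pbracket Z Y = 0" "pbracket W Y = 0"
      "pbracket W Z = - 1"
    using symp pbracket_swap by (metis minus_zero)+
  have "\<forall>i j. pbracket (\<sigma> (var i)) (\<sigma> (var j)) = \<sigma> (pbracket (var i) (var j))"
    unfolding forall_5 v T0 pbracket_self symp swapped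
    by (simp add: pbracket_def pderiv_rat_var h)
  then have pb: "pbracket (\<sigma> f) (\<sigma> g) = \<sigma> (pbracket f g)" for f g
    using pbracket_hom[OF \<sigma>] by blast
  have pb_e: "pbracket f (e * g) = e * pbracket f g" for f g
    using T by (auto simp: pbracket_def pderiv_rat_simps algebra_simps)
  have flow: "ddt a (\<sigma> f) / e = \<sigma> (pbracket f (ham b))" if "pbracket (\<sigma> f) G = pderiv_rat 4 (\<sigma> f)" for f
  proof -
    have "\<sigma> (pbracket f (ham b)) = e * ddt a (\<sigma> f)"
      using that by (simp add: pb[symmetric] H pb_e pbracket_add ddt_eq)
    then show ?thesis using e by (simp add: divide_eq_eq mult.assoc[symmetric] mult.commute)
  qed
  have "pbracket (var 0) f = pderiv_rat 1 f" "pbracket (var 1) f = - pderiv_rat 0 f"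
    "pbracket (var 2) f = pderiv_rat 3 f" "pbracket (var 3) f = - pderiv_rat 2 f" for f
    by (simp_all add: pbracket_def pderiv_rat_var)
  then show ?thesis
    using flow[of "var 0"] flow[of "var 1"] flow[of "var 2"] flow[of "var 3"] G e by (simp add: v)
qed

section \<open>The Hamiltonian in the new variables\<close>

text \<open>The denominators of \<open>new_vars\<close>. They stay in the form
  \<open>d \<noteq> 0\<close>, which the division rules and \<open>nonzero_if_evals_to\<close>
  match; this is why \<open>right_minus_eq\<close> is so often removed from the simplifier.\<close>

fun regular :: "gen \<Rightarrow> 'a::field vars \<Rightarrow> bool" where
  "regular S0 (x, y, z, w, t) \<longleftrightarrow> t \<noteq> 0 \<and> t - 1 \<noteq> 0 \<and> t - z \<noteq> 0"
| "regular S1 (x, y, z, w, t) \<longleftrightarrow> x \<noteq> 0"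
| "regular S2 (x, y, z, w, t) \<longleftrightarrow> y \<noteq> 0"
| "regular S3 (x, y, z, w, t) \<longleftrightarrow> x * z - 1 \<noteq> 0"
| "regular S4 (x, y, z, w, t) \<longleftrightarrow> w \<noteq> 0"
| "regular S5 (x, y, z, w, t) \<longleftrightarrow> z - 1 \<noteq> 0"
| "regular S6 (x, y, z, w, t) \<longleftrightarrow> z \<noteq> 0"
| "regular Phi (x, y, z, w, t) \<longleftrightarrow> x - 1 \<noteq> 0"

text \<open>The polynomial \<open>K\<close>, with \<open>a0\<close> eliminated by the normalization.
  In this form the identities for all generators except \<open>S0\<close> hold for arbitrary
  parameters.\<close>

fun hampoly :: "'a::field params \<Rightarrow> 'a vars \<Rightarrow> 'a" where
  "hampoly (a0, a1, a2, a3, a4, a5, a6) (x, y, z, w, t) =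
     y\<^sup>2 * (t * x - 1) * (x - 1) * x
     + ((a1 + 2 * a2 + 2 * a3 + 2 * a4 + a5 + a6) * t * (x - 1) * x
        - a1 * (x - 1) * (t * x - 1) - (a3 + 2 * a4 + a5) * x * (t * x - 1)) * y
     + a2 * (a2 + a3 + a6) * t * x
     + w\<^sup>2 * (z - t) * (z - 1) * z
     + ((a1 + a3 + 2 * a4 + a5 + a6) * (z - 1) * z - a5 * (z - t) * z - a6 * (z - t) * (z - 1)) * w
     + a4 * (a1 + a3 + a4) * z
     + 2 * x * z * ((t * x - 1) * y + t * a2) * ((z - 1) * w + a4)"

lemma hamiltonian_eq_hampoly:
  assumes "normalized p"
  shows "hamiltonian p (x, y, z, w, t) = hampoly p (x, y, z, w, t) / (t * (t - 1))"
proof (cases p)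
  case (fields a0 a1 a2 a3 a4 a5 a6)
  have n: "2 * a0 + 2 * a1 + 2 * a2 + 2 * a3 + 2 * a4 + a5 + a6 = 1" using assms fields by simp
  have e: "2 * a0 + a1 - 1 = - (a1 + 2 * a2 + 2 * a3 + 2 * a4 + a5 + a6)"
    "2 * a0 + a1 + 2 * a2 + a3 - 1 = - (a1 + a3 + 2 * a4 + a5 + a6)"
    using n by algebra+
  show ?thesis
    unfolding fields hamiltonian.simps H_VI_def H_VI_tilde_def e hampoly.simps
    by (simp add: add_divide_distrib diff_divide_distrib algebra_simps)
qed

section \<open>Transformation of the polynomial Hamiltonian, generator by generator\<close>

context
  fixes a0 a1 a2 a3 a4 a5 a6 x y z w t :: "'a::field"
begin

abbreviation (input) "params \<equiv> (a0, a1, a2, a3, a4, a5, a6)"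
abbreviation (input) "vars \<equiv> (x, y, z, w, t)"

text \<open>Writing the parameter as \<open>u\<close> times the denominator makes the shift
  polynomial, so the claim becomes a polynomial identity. The same device works up to
  \<open>S6\<close>.\<close>

lemma hampoly_S1:
  assumes "x \<noteq> 0"
  shows "hampoly (new_params S1 params) (new_vars S1 params vars) =
    hampoly params vars + a1 * (t * (a1 + 2 * a2 + 2 * a3 + 2 * a4 + a5 + a6) - a3 - 2 * a4 - a5)"
proof -
  obtain u where u: "a1 = u * x" using assms by (metis nonzero_eq_divide_eq)
  then have *: "a1 / x = u" using assms by simp
  show ?thesis unfolding new_vars.simps new_params.simps hampoly.simps * unfolding u by algebra
qed

lemma hampoly_S2:
  assumes "y \<noteq> 0"
  shows "hampoly (new_params S2 params) (new_vars S2 params vars) =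
    hampoly params vars +
      a2 * (a1 + a2 + a3 + 2 * a4 + a5 - t * (a2 + 2 * a3 + 2 * a4 + a5 + a6))"
proof -
  obtain u where u: "a2 = u * y" using assms by (metis nonzero_eq_divide_eq)
  then have *: "a2 / y = u" using assms by simp
  show ?thesis unfolding new_vars.simps new_params.simps hampoly.simps * unfolding u by algebra
qed

lemma hampoly_S3:
  assumes "x * z \<noteq> 1"
  shows "hampoly (new_params S3 params) (new_vars S3 params vars) =
    hampoly params vars"
proof -
  have n: "x * z - 1 \<noteq> 0" using assms by simp
  then obtain u where u: "a3 = u * (x * z - 1)" by (metis nonzero_eq_divide_eq)
  then have *: "a3 * z / (x * z - 1) = u * z" "a3 * x / (x * z - 1) = u * x"  using n by simp_all
  show ?thesis unfolding new_vars.simps new_params.simps hampoly.simps * unfolding u by algebra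
qed

lemma hampoly_S4:
  assumes "w \<noteq> 0"
  shows "hampoly (new_params S4 params) (new_vars S4 params vars) =
    hampoly params vars + a4 * (t * (a4 + a5 + a6) - a1 - a3 - a4 - a5)"
proof -
  obtain u where u: "a4 = u * w" using assms by (metis nonzero_eq_divide_eq)
  then have *: "a4 / w = u" using assms by simp
  show ?thesis unfolding new_vars.simps new_params.simps hampoly.simps * unfolding u by algebra
qed

lemma hampoly_S5:
  assumes "z \<noteq> 1"
  shows "hampoly (new_params S5 params) (new_vars S5 params vars) =
    hampoly params vars - a5 * a6 * t"
proof -
  obtain u where u: "a5 = u * (z - 1)" using assms by (metis nonzero_eq_divide_eq right_minus_eq)
  then have *: "a5 / (z - 1) = u" using assms by simp
  show ?thesis unfolding new_vars.simps new_params.simps hampoly.simps * unfolding u by algebra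
qed

lemma hampoly_S6:
  assumes "z \<noteq> 0"
  shows "hampoly (new_params S6 params) (new_vars S6 params vars) =
    hampoly params vars + a6 * (a1 + a3 + 2 * a4 + a5 + a6 - a5 * t)"
proof -
  obtain u where u: "a6 = u * z" using assms by (metis nonzero_eq_divide_eq right_minus_eq)
  then have *: "a6 / z = u" using assms by simp
  show ?thesis unfolding new_vars.simps new_params.simps hampoly.simps * unfolding u by algebra
qed

text \<open>No parameter can absorb the denominator here; its inverse \<open>q\<close> enters
  instead as a new quantity subject to \<open>(x - 1) * q = 1\<close>.\<close>

lemma hampoly_Phi:
  assumes "x \<noteq> 1"
  shows "hampoly (new_params Phi params) (new_vars Phi params vars) =
    - (hampoly params vars + (a1 * a2 - a1 * a4 - a3 * a4 - a4 * a4))"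
proof -
  define q where "q = 1 / (x - 1)"
  have q: "(x - 1) * q = 1" and *: "x / (x - 1) = x * q" using assms by (simp_all add: q_def)
  show ?thesis unfolding new_vars.simps new_params.simps hampoly.simps * using q by algebra
qed

text \<open>The auxiliary coordinates are read off from the new variables: \<open>d\<close> is the
  denominator of the new \<open>z\<close>, which becomes \<open>(t - 1) * (e - 1)\<close>; the new
  \<open>w\<close> becomes \<open>d * n\<close>, and the new \<open>x\<close> becomes
  \<open>1 + t\<^sup>2 * m\<close>.\<close>

lemma hampoly_S0:
  assumes "t \<noteq> 0" "t \<noteq> 1" "t \<noteq> z" "normalized params"
  shows "hampoly (new_params S0 params) (new_vars S0 params vars) =
    - (hampoly params vars + ((1 - x) * y + z * (1 - z) * w - a4 * z - a2 * (a2 + a3 + a6) + a4 * a6))"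
proof -
  define d where "d = t - z"
  define e where "e = t / d"
  define b where "b = a4 / d"
  define n where "n = (w - b) / (e * (t - 1))"
  define u where "u = y / t"
  define m where "m = (x - 1) / (t * (t - 1))"
  \<comment> \<open>In the coordinates \<open>d, e, b, n, u, m\<close> both the old and the new variables are polynomial,
    so the identity needs no division.\<close>
  have nz: "d \<noteq> 0" "t - 1 \<noteq> 0" "e \<noteq> 0" using assms by (simp_all add: d_def e_def)
  have t: "t = d * e" and z: "z = d * (e - 1)" and a4: "a4 = d * b"
    and x: "x = 1 + t * (t - 1) * m" and y: "y = t * u" and w: "w = b + e * (t - 1) * n"
    using assms nz by (simp_all add: e_def b_def u_def m_def n_def) (simp add: d_def field_simps)
  \<comment> \<open>The new \<open>a1\<close> brings in \<open>a0\<close>, which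
    \<open>hampoly\<close> does not contain; the normalization trades it for the other
    parameters.\<close>
  have a: "a1 + 2 * a0 = 1 - (a1 + 2 * a2 + 2 * a3 + 2 * a4 + a5 + a6)"
  proof -
    have "2 * a0 + 2 * a1 + 2 * a2 + 2 * a3 + 2 * a4 + a5 + a6 = 1" using assms by simp
    then show ?thesis by algebra
  qed
  have 1: "(t * x - 1) / (t - 1) = 1 + t\<^sup>2 * m"
    using nz unfolding x by (subst nonzero_divide_eq_eq) (simp, algebra)
  have 2: "(t - 1) * y / t = (t - 1) * u" using assms unfolding y by simp
  have 3: "(t - 1) * z / (t - z) = (t - 1) * (e - 1)"
    using nz unfolding d_def[symmetric] unfolding z by simp
  have 4: "(t - z) * (t * w - z * w - a4) / (t * (t - 1)) = d * n"
  proof -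
    have "(t - z) * (t * w - z * w - a4) = d * (d * w - a4)" by (simp add: d_def algebra_simps)
    also have "\<dots> = d * n * (t * (t - 1))" unfolding a4 w by (simp add: algebra_simps t)
    finally show ?thesis using nz assms by simp
  qed
  show ?thesis unfolding new_vars.simps new_params.simps a hampoly.simps 1 2 3 4
    unfolding x y z w a4 unfolding t by algebra
qed

end

lemma normalized_new_params: "normalized p \<Longrightarrow> normalized (new_params g p)"
  by (cases g; cases p) (simp_all add: algebra_simps)

text \<open>The derivative of the new independent variable with respect to \<open>t\<close>.\<close>

definition orientation :: "gen \<Rightarrow> 'a::field" where
  "orientation g = (if g \<in> {S0, Phi} then - 1 else 1)"

text \<open>For \<open>S0\<close>, matching the bracket of the new \<open>x\<close> with its
  explicit \<open>t\<close>-derivative forces the coefficient \<open>1 - x\<close> of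
  \<open>y\<close>, and the new \<open>z\<close> likewise forces \<open>z * (1 - z)\<close> as
  coefficient of \<open>w\<close>. The term \<open>- a4 * z\<close> accounts for the new
  \<open>w\<close>; the remaining terms are constants, which the bracket does not see.\<close>

fun hampoly_shift :: "gen \<Rightarrow> 'a::field params \<Rightarrow> 'a vars \<Rightarrow> 'a" where
  "hampoly_shift S0 (a0, a1, a2, a3, a4, a5, a6) (x, y, z, w, t) =
     (1 - x) * y + z * (1 - z) * w - a4 * z - a2 * (a2 + a3 + a6) + a4 * a6"
| "hampoly_shift S1 (a0, a1, a2, a3, a4, a5, a6) (x, y, z, w, t) =
     a1 * (t * (a1 + 2 * a2 + 2 * a3 + 2 * a4 + a5 + a6) - a3 - 2 * a4 - a5)"
| "hampoly_shift S2 (a0, a1, a2, a3, a4, a5, a6) (x, y, z, w, t) =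
     a2 * (a1 + a2 + a3 + 2 * a4 + a5 - t * (a2 + 2 * a3 + 2 * a4 + a5 + a6))"
| "hampoly_shift S3 (a0, a1, a2, a3, a4, a5, a6) (x, y, z, w, t) = 0"
| "hampoly_shift S4 (a0, a1, a2, a3, a4, a5, a6) (x, y, z, w, t) =
     a4 * (t * (a4 + a5 + a6) - a1 - a3 - a4 - a5)"
| "hampoly_shift S5 (a0, a1, a2, a3, a4, a5, a6) (x, y, z, w, t) = - (a5 * a6 * t)"
| "hampoly_shift S6 (a0, a1, a2, a3, a4, a5, a6) (x, y, z, w, t) =
     a6 * (a1 + a3 + 2 * a4 + a5 + a6 - a5 * t)"
| "hampoly_shift Phi (a0, a1, a2, a3, a4, a5, a6) (x, y, z, w, t) =
     a1 * a2 - a1 * a4 - a3 * a4 - a4 * a4"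

lemma hampoly_new:
  assumes "regular g v" "normalized p"
  shows "hampoly (new_params g p) (new_vars g p v) = orientation g * (hampoly p v + hampoly_shift g p v)"
proof -
  obtain a0 a1 a2 a3 a4 a5 a6 x y z w t where p: "p = (a0, a1, a2, a3, a4, a5, a6)" and v: "v = (x, y, z, w, t)"
    by (metis prod.collapse)
  show ?thesis
  proof (cases g)
    case S0
    show ?thesis
      using assms hampoly_S0[of t z a0 a1 a2 a3 a4 a5 a6 x y w] unfolding S0 p v
      by (simp only: regular.simps right_minus_eq hampoly_shift.simps)
        (simp add: orientation_def del: hampoly.simps new_vars.simps new_params.simps)
  qed (use assms hampoly_S1[of x a0 a1 a2 a3 a4 a5 a6 y z w t] hampoly_S2[of y a0 a1 a2 a3 a4 a5 a6 x z w t]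
      hampoly_S3[of x z a0 a1 a2 a3 a4 a5 a6 y w t] hampoly_S4[of w a0 a1 a2 a3 a4 a5 a6 x y z t]
      hampoly_S5[of z a0 a1 a2 a3 a4 a5 a6 x y w t] hampoly_S6[of z a0 a1 a2 a3 a4 a5 a6 x y w t]
      hampoly_Phi[of x a0 a1 a2 a3 a4 a5 a6 y z w t] in
      \<open>simp_all add: p v orientation_def del: hampoly.simps new_vars.simps new_params.simps\<close>)
qed

text \<open>Passing from \<open>K\<close> to \<open>H\<close> is harmless because the factor
  \<open>t * (t - 1)\<close> is invariant under \<open>t \<mapsto> 1 - t\<close>.\<close>

lemma hamiltonian_new:
  assumes "regular g (x, y, z, w, t)" "normalized p"
  shows "hamiltonian (new_params g p) (new_vars g p (x, y, z, w, t)) =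
    orientation g * (hamiltonian p (x, y, z, w, t) + hampoly_shift g p (x, y, z, w, t) / (t * (t - 1)))"
proof -
  obtain x' y' z' w' t' where v': "new_vars g p (x, y, z, w, t) = (x', y', z', w', t')"
    by (metis prod.collapse)
  have "t' = t \<or> t' = 1 - t"
    using v' by (cases g; cases p) auto
  moreover have "(1 - t) * (1 - t - 1) = t * (t - 1)" by algebra
  ultimately have "t' * (t' - 1) = t * (t - 1)" by auto
  then show ?thesis
    using hampoly_new[OF assms] assms(2)
    by (simp add: v' hamiltonian_eq_hampoly normalized_new_params add_divide_distrib[symmetric]
        del: hampoly.simps hamiltonian.simps)
qed

section \<open>Relations between the generators\<close>

fun act :: "gen \<Rightarrow> 'a::field params \<times> 'a vars \<Rightarrow> 'a params \<times> 'a vars" where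
  "act g (p, v) = (new_params g p, new_vars g p v)"

text \<open>Division by zero gives 0, so the formulas have values at poles too, but identities may
  fail there. Regularity is therefore asked before every letter, at the point reached so
  far.\<close>

fun regular_word :: "gen list \<Rightarrow> 'a::field params \<times> 'a vars \<Rightarrow> bool" where
  "regular_word [] s \<longleftrightarrow> True"
| "regular_word (g # gs) s \<longleftrightarrow> regular g (snd s) \<and> regular_word gs (act g s)"

text \<open>Factored forms of the denominators that a second \<open>S0\<close> and a following
  \<open>Phi\<close> meet after \<open>S0\<close>.\<close>

lemma S0_denominators:
  fixes t :: "'a::field"
  assumes "t - 1 \<noteq> 0" "t - z \<noteq> 0"
  shows "1 - t - (t - 1) * z / (t - z) = - (t * (t - 1) / (t - z))"
    "(t * x - 1) / (t - 1) - 1 = t * (x - 1) / (t - 1)"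
proof -
  show "1 - t - (t - 1) * z / (t - z) = - (t * (t - 1) / (t - z))"
    using assms by (simp add: divide_simps del: right_minus_eq) algebra
  show "(t * x - 1) / (t - 1) - 1 = t * (x - 1) / (t - 1)"
    using assms by (simp add: divide_simps del: right_minus_eq) algebra
qed

text \<open>The braid relation in rank two, for \<open>Y \<mapsto> Y - a / X\<close> and \<open>X \<mapsto> X + b / Y\<close>. The
  relations of order three are of this form, except that \<open>S\<^sub>3\<close> shifts two variables.\<close>

lemma A2_braid:
  fixes X Y a b :: "'a::field"
  assumes "X \<noteq> 0" "Y \<noteq> 0" "Y - a / X \<noteq> 0" "X + b / Y \<noteq> 0"
  shows "X + (b + a) / (Y - a / X) = X + b / Y + a / (Y - (a + b) / (X + b / Y))"
    "Y - a / X - b / (X + (b + a) / (Y - a / X)) = Y - (a + b) / (X + b / Y)"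
proof -
  have nz: "X * Y - a \<noteq> 0" "X * Y + b \<noteq> 0" using assms by (auto simp: field_simps)
  have Y1: "Y - a / X = (X * Y - a) / X" and X1: "X + b / Y = (X * Y + b) / Y"
    using assms by (simp_all add: field_simps)
  have X2: "X + (b + a) / (Y - a / X) = X * (X * Y + b) / (X * Y - a)"
    unfolding Y1 using assms nz by (simp add: divide_simps) algebra
  have Y2: "Y - (a + b) / (X + b / Y) = Y * (X * Y - a) / (X * Y + b)"
    unfolding X1 using assms nz by (simp add: divide_simps) algebra
  show "X + (b + a) / (Y - a / X) = X + b / Y + a / (Y - (a + b) / (X + b / Y))"
    unfolding X2 Y2 unfolding X1 using assms nz by (simp add: divide_simps del: right_minus_eq) algebra
  show "Y - a / X - b / (X + (b + a) / (Y - a / X)) = Y - (a + b) / (X + b / Y)"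
    unfolding X2 Y2 unfolding Y1 using assms nz by (simp add: divide_simps del: right_minus_eq) algebra
qed

text \<open>The first two equations are the braid relation for the pair \<open>x, y\<close>; the
  third follows \<open>w\<close>, which \<open>S3\<close> shifts along with
  \<open>y\<close>.\<close>

lemma S3_braid:
  fixes x y z w a b :: "'a::field"
  assumes "x * z - 1 \<noteq> 0" "y \<noteq> 0" "y - a * z / (x * z - 1) \<noteq> 0" "(x + b / y) * z - 1 \<noteq> 0"
  shows "x + (b + a) / (y - a * z / (x * z - 1)) = x + b / y + a / (y - (a + b) * z / ((x + b / y) * z - 1))"
    "y - a * z / (x * z - 1) - b * z / ((x + (b + a) / (y - a * z / (x * z - 1))) * z - 1) =
      y - (a + b) * z / ((x + b / y) * z - 1)"
    "w - a * x / (x * z - 1) - b * (x + (b + a) / (y - a * z / (x * z - 1))) /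
        ((x + (b + a) / (y - a * z / (x * z - 1))) * z - 1) =
      w - (a + b) * (x + b / y) / ((x + b / y) * z - 1)"
proof -
  define d where "d = x * z - 1"
  have d: "d \<noteq> 0" "x * z = d + 1" using assms(1) by (simp_all add: d_def)
  have Y1: "y - a * z / (x * z - 1) = (d * y - a * z) / d" and X1: "x + b / y = (x * y + b) / y"
    and Q1: "(x + b / y) * z - 1 = (d * y + b * z) / y"
    using d(1) assms(2) by (simp_all add: field_simps d_def)
  have nz: "d * y - a * z \<noteq> 0" "d * y + b * z \<noteq> 0" using assms Y1 Q1 by auto
  have X2: "x + (b + a) / (y - a * z / (x * z - 1)) = (x * (d * y + b * z) - (a + b)) / (d * y - a * z)"
    unfolding Y1 using d nz by (simp add: divide_simps del: right_minus_eq) algebra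
  have Q2: "(x + (b + a) / (y - a * z / (x * z - 1))) * z - 1 = d * (d * y + b * z) / (d * y - a * z)"
    unfolding Y1 using d nz by (simp add: divide_simps del: right_minus_eq) algebra
  have Y2: "y - (a + b) * z / ((x + b / y) * z - 1) = y * (d * y - a * z) / (d * y + b * z)"
    unfolding Q1 using assms nz by (simp add: divide_simps del: right_minus_eq) algebra
  \<comment> \<open>The numerators of both sides over the common denominator
    \<open>y * (d * y - a * z)\<close>; the terms \<open>a * b * z\<close> cancel.\<close>
  have "(x * (d * y - a * z) + (b + a) * d) * y = (x * y + b) * (d * y - a * z) + a * (d * y + b * z)"
    by algebra
  then show "x + (b + a) / (y - a * z / (x * z - 1)) = x + b / y + a / (y - (a + b) * z / ((x + b / y) * z - 1))"
    unfolding Y2 unfolding Y1 using d assms nz by (simp add: divide_simps del: right_minus_eq)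
  show "y - a * z / (x * z - 1) - b * z / ((x + (b + a) / (y - a * z / (x * z - 1))) * z - 1) =
      y - (a + b) * z / ((x + b / y) * z - 1)"
    unfolding Q2 Y2 unfolding Y1 using d assms nz
    by (simp add: divide_simps del: right_minus_eq) (simp add: algebra_simps)
  have "b * (x + (b + a) / (y - a * z / (x * z - 1))) /
        ((x + (b + a) / (y - a * z / (x * z - 1))) * z - 1) =
      b * (x * (d * y + b * z) - (a + b)) / (d * (d * y + b * z))"
    unfolding Q2 unfolding X2 using d nz by (simp add: divide_simps del: right_minus_eq)
  then show "w - a * x / (x * z - 1) - b * (x + (b + a) / (y - a * z / (x * z - 1))) /
        ((x + (b + a) / (y - a * z / (x * z - 1))) * z - 1) =
      w - (a + b) * (x + b / y) / ((x + b / y) * z - 1)"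
    unfolding Q1 X1 d_def[symmetric] using d assms nz by (simp add: divide_simps del: right_minus_eq) algebra
qed

section \<open>Involutions, commutations and braid relations at a single point\<close>

context
  fixes a0 a1 a2 a3 a4 a5 a6 x y z w t :: "'a::field"
begin

abbreviation (input) "point \<equiv> ((a0, a1, a2, a3, a4, a5, a6), (x, y, z, w, t))"

lemma act_S0_S2:
  assumes "t \<noteq> 0"
  shows "act S2 (act S0 point) = act S0 (act S2 point)"
proof -
  have 1: "t * (x + a2 / y) - 1 = (t * x - 1) + t * a2 / y"
    by (simp add: algebra_simps)
  have 2: "a2 / ((t - 1) * y / t) = t * a2 / y / (t - 1)"
    by (simp add: mult.commute)
  show ?thesis
    unfolding act.simps new_vars.simps new_params.simps 1 2 by (simp only: add_divide_distrib ac_simps)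
qed

lemma act_Phi_Phi: "x - 1 \<noteq> 0 \<Longrightarrow> act Phi (act Phi point) = point"
proof -
  assume n: "x - 1 \<noteq> 0"
  then have 1: "x / (x - 1) - 1 = 1 / (x - 1)" by (simp add: divide_simps)
  have "1 / (x - 1) * (- (x - 1) * ((x - 1) * y + a2)) = - ((x - 1) * y + a2)"
    using n by (simp add: divide_simps del: right_minus_eq) algebra
  then have 2: "- (1 / (x - 1)) * (1 / (x - 1) * (- (x - 1) * ((x - 1) * y + a2)) + a2) = y"
    using n by simp
  show ?thesis unfolding act.simps new_vars.simps new_params.simps 1 2 using n by simp
qed

lemma act_S0_S0:
  assumes "t \<noteq> 0" "t - 1 \<noteq> 0" "t - z \<noteq> 0"
  shows "act S0 (act S0 point) = point"
proof -
  define w' where "w' = (t - z) * (t * w - z * w - a4) / (t * (t - 1))"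
  note f = S0_denominators[OF assms(2,3)]
  have "((1 - t) * ((t * x - 1) / (t - 1)) - 1) / (1 - t - 1) = x"
  proof -
    have "(1 - t) * ((t * x - 1) / (t - 1)) = 1 - t * x"
      using assms(2) by (simp add: divide_simps del: right_minus_eq) algebra
    then show ?thesis using assms(1) by simp
  qed
  moreover have "(1 - t - 1) * ((t - 1) * y / t) / (1 - t) = y"
  proof -
    have s: "1 - t = - (t - 1)" by simp
    show ?thesis unfolding s using assms by (simp del: minus_diff_eq right_minus_eq)
  qed
  moreover have "(1 - t - 1) * ((t - 1) * z / (t - z)) / - (t * (t - 1) / (t - z)) = z"
    using assms by (simp del: right_minus_eq)
  moreover have "- (t * (t - 1) / (t - z)) * ((1 - t) * w' - ((t - 1) * z / (t - z)) * w' - a4) /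
      ((1 - t) * (1 - t - 1)) = w"
  proof -
    have "(1 - t) * w' - ((t - 1) * z / (t - z)) * w' - a4 = - (t * (t - 1) / (t - z)) * w' - a4"
      unfolding f(1)[symmetric] by (simp only: left_diff_distrib)
    \<comment> \<open>Multiplied by the denominator of the second \<open>S0\<close>, the
      intermediate \<open>w'\<close> loses its own, and the two occurrences of \<open>a4\<close>
      cancel.\<close>
    moreover have "(t * (t - 1) / (t - z)) * w' = (t - z) * w - a4"
      using assms unfolding w'_def by (simp add: left_diff_distrib[of t z w] del: right_minus_eq)
    ultimately have *: "(1 - t) * w' - ((t - 1) * z / (t - z)) * w' - a4 = - ((t - z) * w)"
      by simp
    have "(1 - t) * (1 - t - 1) = t * (t - 1)" by algebra
    then show ?thesis unfolding * using assms by (simp del: right_minus_eq)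
  qed
  ultimately show ?thesis
    unfolding act.simps new_vars.simps new_params.simps w'_def[symmetric] f(1) by simp
qed

text \<open>The factor \<open>(t - z) * w - a4\<close> plays two parts: it occurs in the numerator
  of the new \<open>w\<close> under \<open>S0\<close>, by which \<open>S4\<close> then divides, and
  over \<open>w\<close> it is the denominator that \<open>S0\<close> meets after
  \<open>S4\<close>.\<close>

lemma act_S0_S4:
  assumes "t \<noteq> 0" "t - 1 \<noteq> 0" "t - z \<noteq> 0" "w \<noteq> 0" "(t - z) * w - a4 \<noteq> 0"
  shows "act S4 (act S0 point) = act S0 (act S4 point)"
proof -
  have 0: "t * w - z * w - a4 = (t - z) * w - a4" by (simp add: left_diff_distrib)
  have 1: "t - (z + a4 / w) = ((t - z) * w - a4) / w" using assms(4) by (simp add: divide_simps) algebra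
  have "(t - 1) * z / (t - z) + a4 / ((t - z) * ((t - z) * w - a4) / (t * (t - 1))) =
      (t - 1) * (z + a4 / w) / (((t - z) * w - a4) / w)"
    using assms by (simp add: divide_simps del: right_minus_eq) algebra
  moreover have "t * w - (z + a4 / w) * w - - a4 = (t - z) * w"
    using assms(4) by (simp add: algebra_simps)
  ultimately show ?thesis unfolding act.simps new_vars.simps new_params.simps 0 1
    using assms by (simp del: right_minus_eq)
qed

lemma act_Phi_S0:
  assumes "t \<noteq> 0" "t - 1 \<noteq> 0" "t - z \<noteq> 0" "x - 1 \<noteq> 0"
  shows "act S0 (act Phi point) = act Phi (act S0 point)"
proof -
  note f = S0_denominators[OF assms(2,3)]
  have s: "1 - t = - (t - 1)" "1 - t - (1 - z) = - (t - z)" "- (t - 1) - 1 = - t" by simp_all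
  have "((1 - t) * (x / (x - 1)) - 1) / (- t) = (t * x - 1) / (t - 1) / (t * (x - 1) / (t - 1))"
    using assms by (simp add: divide_simps del: right_minus_eq) algebra
  moreover have "(- t) * (- (x - 1) * ((x - 1) * y + a2)) / (1 - t) =
      - (t * (x - 1) / (t - 1)) * (t * (x - 1) / (t - 1) * ((t - 1) * y / t) + a2)"
    unfolding s
    using assms by (simp add: divide_simps del: right_minus_eq minus_diff_eq)
  moreover have "(- t) * (1 - z) / (- (t - z)) = 1 - (t - 1) * z / (t - z)"
    using assms by (simp add: divide_simps del: right_minus_eq minus_diff_eq) algebra
  moreover have "- (t - z) * ((1 - t) * (- w) - (1 - z) * (- w) - a4) / ((1 - t) * (- t)) =
      - ((t - z) * (t * w - z * w - a4) / (t * (t - 1)))"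
    unfolding s(1) using assms by (simp add: divide_simps del: right_minus_eq minus_diff_eq) algebra
  ultimately show ?thesis unfolding act.simps new_vars.simps new_params.simps f s(2) by simp
qed

lemma act_Phi_S3:
  assumes "x * z - 1 \<noteq> 0" "x - 1 \<noteq> 0"
  shows "act S3 (act Phi point) = act Phi (act S3 point)"
proof -
  have s: "x / (x - 1) * (1 - z) - 1 = - ((x * z - 1) / (x - 1))"
    using assms(2) by (simp add: divide_simps del: right_minus_eq) algebra
  show ?thesis unfolding act.simps new_vars.simps new_params.simps s
    using assms by (simp add: divide_simps del: right_minus_eq minus_diff_eq) algebra
qed

lemma act_braid_S1_S2:
  assumes "x \<noteq> 0" "y \<noteq> 0" "y - a1 / x \<noteq> 0" "x + a2 / y \<noteq> 0"
  shows "act S1 (act S2 (act S1 point)) = act S2 (act S1 (act S2 point))"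
  using A2_braid[OF assms] by (simp add: ac_simps)

lemma act_braid_S5_S4:
  assumes "z - 1 \<noteq> 0" "w \<noteq> 0" "w - a5 / (z - 1) \<noteq> 0" "z + a4 / w - 1 \<noteq> 0"
  shows "act S5 (act S4 (act S5 point)) = act S4 (act S5 (act S4 point))"
proof -
  \<comment> \<open>Brings the denominators into the form of \<open>A2_braid\<close> with
    \<open>X = z - 1\<close>.\<close>
  have [simp]: "z + u - 1 = z - 1 + u" for u by simp
  show ?thesis
  using A2_braid[of "z - 1" w a5 a4] assms by (simp add: ac_simps del: right_minus_eq)
qed

lemma act_braid_S6_S4:
  assumes "z \<noteq> 0" "w \<noteq> 0" "w - a6 / z \<noteq> 0" "z + a4 / w \<noteq> 0"
  shows "act S6 (act S4 (act S6 point)) = act S4 (act S6 (act S4 point))"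
  using A2_braid[OF assms] by (simp add: ac_simps)

lemma act_braid_S3_S2:
  assumes "x * z - 1 \<noteq> 0" "y \<noteq> 0" "y - a3 * z / (x * z - 1) \<noteq> 0" "(x + a2 / y) * z - 1 \<noteq> 0"
  shows "act S3 (act S2 (act S3 point)) = act S2 (act S3 (act S2 point))"
  using S3_braid[OF assms] by (simp add: ac_simps)

text \<open>Exchanging \<open>x, y\<close> with \<open>z, w\<close> preserves the form of
  \<open>S3\<close> and carries \<open>S2\<close> to \<open>S4\<close>, so this is again
  \<open>S3_braid\<close>.\<close>

lemma act_braid_S3_S4:
  assumes "x * z - 1 \<noteq> 0" "w \<noteq> 0" "w - a3 * x / (x * z - 1) \<noteq> 0" "x * (z + a4 / w) - 1 \<noteq> 0"
  shows "act S3 (act S4 (act S3 point)) = act S4 (act S3 (act S4 point))"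
  using S3_braid(1,2)[where x = z and y = w and z = x and a = a3 and b = a4]
    S3_braid(3)[where x = z and y = w and z = x and w = y and a = a3 and b = a4] assms
  by (simp add: ac_simps del: right_minus_eq)

text \<open>The source of the relation of order 4: conjugated by \<open>S0\<close>,
  \<open>S1\<close> again shifts only \<open>y\<close>, by a function of \<open>x\<close> and
  \<open>t\<close>. Its coefficient \<open>a1 + 2 * a0\<close> is fixed by \<open>S1\<close>, and it
  fixes \<open>a1\<close> in turn, so the two shifts commute.\<close>

lemma act_S0_S1_S0:
  assumes "t \<noteq> 0" "t - 1 \<noteq> 0" "t - z \<noteq> 0"
  shows "act S0 (act S1 (act S0 point)) =
    ((- (a0 + a1), a1, a2 + a1 + 2 * a0, a3, a4, a5, a6), (x, y - (a1 + 2 * a0) * t / (t * x - 1), z, w, t))"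
proof -
  have s: "1 - t = - (t - 1)" by simp
  \<comment> \<open>\<open>S1\<close> leaves \<open>z'\<close> and \<open>w'\<close> alone, so they
    stay opaque and return to \<open>z\<close> and \<open>w\<close> because \<open>S0\<close> is an
    involution.\<close>
  obtain z' w' where A: "act S0 point =
      ((- a0, a1 + 2 * a0, a2, a3, a4, a5, a6), ((t * x - 1) / (t - 1), (t - 1) * y / t, z', w', 1 - t))"
    by simp
  have "act S0 (act S0 point) = point" using act_S0_S0[OF assms] .
  then have 1: "(1 - t - 1) * z' / (1 - t - z') = z"
      "(1 - t - z') * ((1 - t) * w' - z' * w' - a4) / ((1 - t) * (1 - t - 1)) = w"
      "((1 - t) * ((t * x - 1) / (t - 1)) - 1) / (1 - t - 1) = x"
      "(1 - t - 1) * ((t - 1) * y / t) / (1 - t) = y"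
    unfolding A unfolding act.simps new_vars.simps new_params.simps by (simp_all only: prod.inject)
  have "(1 - t - 1) * ((t - 1) * y / t - (a1 + 2 * a0) / ((t * x - 1) / (t - 1))) / (1 - t) =
      (1 - t - 1) * ((t - 1) * y / t) / (1 - t) - (a1 + 2 * a0) * t / (t * x - 1)"
    unfolding right_diff_distrib[of "1 - t - 1"] diff_divide_distrib[of "(1 - t - 1) * _"]
    unfolding s using assms by (simp del: minus_diff_eq right_minus_eq)
  then show ?thesis unfolding A unfolding act.simps new_vars.simps new_params.simps 1 by simp
qed

lemma act_S0_S3:
  "regular_word [S0, S3] point \<Longrightarrow> regular_word [S3, S0] point \<Longrightarrow>
    act S3 (act S0 point) = act S0 (act S3 point)"
  by (simp add: divide_simps) algebra

lemma act_S0_S5: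
  "regular_word [S0, S5] point \<Longrightarrow> regular_word [S5, S0] point \<Longrightarrow>
    act S5 (act S0 point) = act S0 (act S5 point)"
  by (simp add: divide_simps) algebra

lemma act_S0_S6:
  "regular_word [S0, S6] point \<Longrightarrow> regular_word [S6, S0] point \<Longrightarrow>
    act S6 (act S0 point) = act S0 (act S6 point)"
  by (simp add: divide_simps) algebra

lemma act_Phi_S1:
  "regular_word [Phi, S1] point \<Longrightarrow> regular_word [S1, Phi] point \<Longrightarrow>
    act S1 (act Phi point) = act Phi (act S1 point)"
  by (simp add: field_simps)

lemma act_Phi_S2:
  "regular_word [Phi, S2] point \<Longrightarrow> regular_word [S2, Phi] point \<Longrightarrow>
    act S2 (act Phi point) = act Phi (act S2 point)"
  by (simp add: divide_simps) algebra

lemma act_Phi_S4: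
  "regular_word [Phi, S4] point \<Longrightarrow> regular_word [S4, Phi] point \<Longrightarrow>
    act S4 (act Phi point) = act Phi (act S4 point)"
  by (simp add: field_simps)

lemma act_Phi_S5:
  "regular_word [Phi, S5] point \<Longrightarrow> regular_word [S6, Phi] point \<Longrightarrow>
    act S5 (act Phi point) = act Phi (act S6 point)"
  by (simp add: field_simps)

lemma act_Phi_S6:
  "regular_word [Phi, S6] point \<Longrightarrow> regular_word [S5, Phi] point \<Longrightarrow>
    act S6 (act Phi point) = act Phi (act S5 point)"
  by (simp add: field_simps)

end

lemma new_params_involution: "new_params g (new_params g p) = p"
  by (cases g; cases p) simp_all

lemma act_involution:
  assumes "regular g v"
  shows "act g (act g (p, v)) = (p, v)"
proof -
  obtain a0 a1 a2 a3 a4 a5 a6 x y z w t where s: "p = (a0, a1, a2, a3, a4, a5, a6)" "v = (x, y, z, w, t)"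
    by (metis prod.collapse)
  show ?thesis
  proof (cases g)
    case S0
    have "t \<noteq> 0" "t - 1 \<noteq> 0" "t - z \<noteq> 0" using assms by (simp_all add: s S0)
    then show ?thesis unfolding S0 s by (rule act_S0_S0)
  next
    case Phi
    have "x - 1 \<noteq> 0" using assms by (simp add: s Phi)
    then show ?thesis unfolding Phi s by (rule act_Phi_Phi)
  qed (use assms in \<open>simp_all add: s\<close>)
qed

section \<open>Words in the generators and the Coxeter relations\<close>

fun act_word :: "gen list \<Rightarrow> 'a::field params \<times> 'a vars \<Rightarrow> 'a params \<times> 'a vars" where
  "act_word [] s = s"
| "act_word (g # gs) s = act_word gs (act g s)"

fun alternating :: "nat \<Rightarrow> 'a \<Rightarrow> 'a \<Rightarrow> 'a list" where
  "alternating 0 i j = []"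
| "alternating (Suc n) i j = i # alternating n j i"

text \<open>In each pair neither generator changes the parameter or the variables on which the shift
  of the other depends, so the shifts simply add, at poles as well.\<close>

lemma act_commute:
  assumes "(i, j) \<in> {(S1, S3), (S1, S4), (S1, S5), (S1, S6), (S2, S4), (S2, S5), (S2, S6),
      (S3, S5), (S3, S6), (S5, S6)}"
  shows "act j (act i s) = act i (act j s)"
proof -
  obtain a0 a1 a2 a3 a4 a5 a6 x y z w t where s: "s = ((a0, a1, a2, a3, a4, a5, a6), (x, y, z, w, t))"
    by (metis prod.collapse)
  show ?thesis using assms unfolding s by (elim insertE emptyE Pair_inject) (simp_all add: algebra_simps)
qed

lemma act_S0_commute:
  assumes "j \<in> {S2, S3, S4, S5, S6}" "regular_word [S0, j] s" "regular_word [j, S0] s"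
  shows "act j (act S0 s) = act S0 (act j s)"
proof -
  obtain a0 a1 a2 a3 a4 a5 a6 x y z w t where s: "s = ((a0, a1, a2, a3, a4, a5, a6), (x, y, z, w, t))"
    by (metis prod.collapse)
  show ?thesis
  using assms(1)
  proof (elim insertE emptyE)
    assume j: "j = S2"
    show ?thesis using assms unfolding s j by (intro act_S0_S2) simp
  next
    assume j: "j = S3"
    show ?thesis using assms unfolding s j by (intro act_S0_S3)
  next
    assume j: "j = S4"
    have "t - z \<noteq> 0" "w \<noteq> 0" "(t - z) * (t * w - z * w - a4) / (t * (t - 1)) \<noteq> 0" "t \<noteq> 0" "t - 1 \<noteq> 0"
      using assms unfolding s j by simp_all
    then show ?thesis unfolding s j by (intro act_S0_S4) (auto simp: left_diff_distrib)
  next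
    assume j: "j = S5"
    show ?thesis using assms unfolding s j by (intro act_S0_S5)
  next
    assume j: "j = S6"
    show ?thesis using assms unfolding s j by (intro act_S0_S6)
  qed
qed

lemma act_braid:
  assumes "(i, j) \<in> {(S1, S2), (S3, S2), (S3, S4), (S5, S4), (S6, S4)}"
    "regular_word [i, j, i] s" "regular_word [j, i, j] s"
  shows "act i (act j (act i s)) = act j (act i (act j s))"
proof -
  obtain a0 a1 a2 a3 a4 a5 a6 x y z w t where s: "s = ((a0, a1, a2, a3, a4, a5, a6), (x, y, z, w, t))"
    by (metis prod.collapse)
  show ?thesis
    using assms(1) unfolding s
    by (elim insertE emptyE Pair_inject; hypsubst;
        intro act_braid_S1_S2 act_braid_S3_S2 act_braid_S3_S4 act_braid_S5_S4 act_braid_S6_S4)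
      (use assms(2,3) in \<open>simp_all add: s del: right_minus_eq\<close>)
qed

lemma act_braid_S0_S1:
  assumes "regular_word [S0] s" "regular_word [S1, S0] s"
  shows "act S1 (act S0 (act S1 (act S0 s))) = act S0 (act S1 (act S0 (act S1 s)))"
proof -
  obtain a0 a1 a2 a3 a4 a5 a6 x y z w t where s: "s = ((a0, a1, a2, a3, a4, a5, a6), (x, y, z, w, t))"
    by (metis prod.collapse)
  have nz: "t \<noteq> 0" "t - 1 \<noteq> 0" "t - z \<noteq> 0" using assms by (simp_all add: s)
  show ?thesis
    unfolding s act.simps[of S1 _ "(x, y, z, w, t)"] new_params.simps new_vars.simps act_S0_S1_S0[OF nz]
    by (simp add: algebra_simps)
qed

text \<open>For involutions the relation with exponent \<open>m\<close> is the equality of the two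
  alternating words of length \<open>m\<close>, which halves the depth of the nested
  fractions.\<close>

lemma coxeter_act:
  assumes "i \<in> reflections" "j \<in> reflections" "i \<noteq> j"
    and "\<And>ws. regular_word ws s"
  shows "act_word (alternating (coxeter_B6 i j) i j) s = act_word (alternating (coxeter_B6 i j) j i) s"
proof -
  define C where "C i j \<longleftrightarrow>
    act_word (alternating (coxeter_B6 i j) i j) s = act_word (alternating (coxeter_B6 i j) j i) s" for i j
  have comm: "C i j" if "(i, j) \<in> {(S1, S3), (S1, S4), (S1, S5), (S1, S6), (S2, S4), (S2, S5), (S2, S6),
      (S3, S5), (S3, S6), (S5, S6)}" for i j
  proof -
    have "coxeter_B6 i j = 2" using that by (auto simp: coxeter_B6_def doubleton_eq_iff)
    then show ?thesis using act_commute[OF that] by (simp add: C_def eval_nat_numeral del: act.simps)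
  qed
  have comm0: "C S0 j" if "j \<in> {S2, S3, S4, S5, S6}" for j
  proof -
    have "coxeter_B6 S0 j = 2" using that by (auto simp: coxeter_B6_def doubleton_eq_iff)
    then show ?thesis using act_S0_commute[OF that assms(4) assms(4)]
      by (simp add: C_def eval_nat_numeral del: act.simps)
  qed
  have braid: "C i j" if "(i, j) \<in> {(S1, S2), (S3, S2), (S3, S4), (S5, S4), (S6, S4)}" for i j
  proof -
    have "coxeter_B6 i j = 3" using that by (auto simp: coxeter_B6_def doubleton_eq_iff)
    then show ?thesis using act_braid[OF that assms(4) assms(4)]
      by (simp add: C_def eval_nat_numeral del: act.simps)
  qed
  have braid01: "C S0 S1"
    using act_braid_S0_S1[OF assms(4) assms(4)]
    by (simp add: C_def coxeter_B6_def eval_nat_numeral del: act.simps)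
  have sym: "C i j \<longleftrightarrow> C j i" for i j
  proof -
    have "coxeter_B6 i j = coxeter_B6 j i" by (simp add: coxeter_B6_def insert_commute)
    then show ?thesis unfolding C_def by (metis (no_types))
  qed
  \<comment> \<open>One orientation of every unordered pair except \<open>S0, S1\<close>, which is
    \<open>braid01\<close>.\<close>
  have "C S1 S3" "C S1 S4" "C S1 S5" "C S1 S6" "C S2 S4" "C S2 S5" "C S2 S6" "C S3 S5" "C S3 S6" "C S5 S6"
    "C S0 S2" "C S0 S3" "C S0 S4" "C S0 S5" "C S0 S6" "C S1 S2" "C S3 S2" "C S3 S4" "C S5 S4" "C S6 S4"
    by (simp_all add: comm comm0 braid)
  then have "C i j \<or> C j i"
    using assms(1-3) braid01 by (cases i; cases j) (simp_all add: reflections_def)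
  then have "C i j" using sym by blast
  then show ?thesis by (simp add: C_def)
qed

lemma act_Phi:
  assumes "i \<in> reflections" "regular_word [Phi, i] s" "regular_word [diagram_aut i, Phi] s"
  shows "act i (act Phi s) = act Phi (act (diagram_aut i) s)"
proof -
  obtain a0 a1 a2 a3 a4 a5 a6 x y z w t where s: "s = ((a0, a1, a2, a3, a4, a5, a6), (x, y, z, w, t))"
    by (metis prod.collapse)
  show ?thesis
  proof (cases "i = S0")
    case True
    have "t \<noteq> 0" "t - 1 \<noteq> 0" "t - z \<noteq> 0" "x - 1 \<noteq> 0"
      using assms(2,3) by (simp_all add: s True diagram_aut_def)
    from act_Phi_S0[OF this] show ?thesis by (simp add: s True diagram_aut_def del: act.simps)
  next
    case False
    then consider "i = S1" | "i = S2" | "i = S3" | "i = S4" | "i = S5" | "i = S6"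
      using assms(1) by (auto simp: reflections_def)
    then show ?thesis
    proof cases
      case 1
      then show ?thesis using act_Phi_S1 assms(2,3)
        by (simp add: s diagram_aut_def del: act.simps regular_word.simps)
    next
      case 2
      then show ?thesis using act_Phi_S2 assms(2,3)
        by (simp add: s diagram_aut_def del: act.simps regular_word.simps)
    next
      case 3
      have "x * z - 1 \<noteq> 0" "x - 1 \<noteq> 0" using assms(2,3) by (simp_all add: s 3 diagram_aut_def)
      from act_Phi_S3[OF this] show ?thesis by (simp add: s 3 diagram_aut_def del: act.simps)
    next
      case 4
      then show ?thesis using act_Phi_S4 assms(2,3)
        by (simp add: s diagram_aut_def del: act.simps regular_word.simps)
    next
      case 5
      then show ?thesis using act_Phi_S5 assms(2,3)
        by (simp add: s diagram_aut_def del: act.simps regular_word.simps)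
    next
      case 6
      then show ?thesis using act_Phi_S6 assms(2,3)
        by (simp add: s diagram_aut_def del: act.simps regular_word.simps)
    qed
  qed
qed

section \<open>The Baecklund property\<close>

text \<open>Inverting a generator means evaluating the same formula at its image, where the
  denominators must survive as well.\<close>

lemma regular_new_vars: "regular g v \<Longrightarrow> regular g (new_vars g p v)"
proof -
  assume r: "regular g v"
  obtain a0 a1 a2 a3 a4 a5 a6 x y z w t where p: "p = (a0, a1, a2, a3, a4, a5, a6)" and v: "v = (x, y, z, w, t)"
    by (metis prod.collapse)
  have "x \<noteq> 1 \<Longrightarrow> x / (x - 1) - 1 \<noteq> 0" by (simp add: field_simps)
  then show ?thesis using r S0_denominators(1)[of t z] by (cases g) (auto simp: p v)
qed

section \<open>Points related by evaluation\<close>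

fun vars_rel :: "('a \<Rightarrow> 'b \<Rightarrow> bool) \<Rightarrow> 'a vars \<Rightarrow> 'b vars \<Rightarrow> bool" where
  "vars_rel R (x, y, z, w, t) (x', y', z', w', t') \<longleftrightarrow> R x x' \<and> R y y' \<and> R z z' \<and> R w w' \<and> R t t'"

fun params_rel :: "('a \<Rightarrow> 'b \<Rightarrow> bool) \<Rightarrow> 'a params \<Rightarrow> 'b params \<Rightarrow> bool" where
  "params_rel R (a0, a1, a2, a3, a4, a5, a6) (b0, b1, b2, b3, b4, b5, b6) \<longleftrightarrow>
     R a0 b0 \<and> R a1 b1 \<and> R a2 b2 \<and> R a3 b3 \<and> R a4 b4 \<and> R a5 b5 \<and> R a6 b6"

context evaluation
begin

lemma regular_if_evals_to:
  assumes "vars_rel evals_to v v'" "regular g v'"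
  shows "regular g v"
proof -
  obtain x y z w t x' y' z' w' t' where v: "v = (x, y, z, w, t)" "v' = (x', y', z', w', t')"
    by (metis prod.collapse)
  have "evals_to x x'" "evals_to y y'" "evals_to z z'" "evals_to w w'" "evals_to t t'"
    using assms by (simp_all add: v)
  note e = this evals_to_diff[OF this(5) evals_to_1] evals_to_diff[OF this(5,3)]
    evals_to_diff[OF evals_to_mult[OF this(1,3)] evals_to_1] evals_to_diff[OF this(3) evals_to_1]
    evals_to_diff[OF this(1) evals_to_1]
  show ?thesis
    using e[THEN nonzero_if_evals_to] assms(2) by (cases g) (simp_all add: v)
qed

lemma evals_to_const_params: "params_rel evals_to (map_params const a) (map_params c a)"
  by (cases a) (simp add: evals_to_const)

lemma evals_to_new_vars:
  assumes "params_rel evals_to p p'" "vars_rel evals_to v v'" "regular g v'"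
  shows "vars_rel evals_to (new_vars g p v) (new_vars g p' v')"
proof -
  obtain x y z w t x' y' z' w' t' where v: "v = (x, y, z, w, t)" "v' = (x', y', z', w', t')"
    by (metis prod.collapse)
  obtain a0 a1 a2 a3 a4 a5 a6 b0 b1 b2 b3 b4 b5 b6 where
    p: "p = (a0, a1, a2, a3, a4, a5, a6)" "p' = (b0, b1, b2, b3, b4, b5, b6)"
    by (metis prod.collapse)
  show ?thesis
    using assms unfolding v p
    by (cases g) (simp_all del: right_minus_eq add: evals_to_intros)
qed

lemma evals_to_new_params:
  assumes "params_rel evals_to p p'"
  shows "params_rel evals_to (new_params g p) (new_params g p')"
proof -
  obtain a0 a1 a2 a3 a4 a5 a6 b0 b1 b2 b3 b4 b5 b6 where
    p: "p = (a0, a1, a2, a3, a4, a5, a6)" "p' = (b0, b1, b2, b3, b4, b5, b6)"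
    by (metis prod.collapse)
  show ?thesis
    using assms unfolding p by (cases g) (simp_all add: evals_to_intros)
qed

end

section \<open>Naturality of the formulas under homomorphisms\<close>

lemma map_new_vars:
  assumes "ratfun_hom \<sigma>"
  shows "map_vars \<sigma> (new_vars g p v) = new_vars g (map_params \<sigma> p) (map_vars \<sigma> v)"
  by (cases g; cases p; cases v) (simp_all add: ratfun_hom_simps[OF assms])

lemma map_new_params:
  assumes "ratfun_hom \<sigma>"
  shows "map_params \<sigma> (new_params g p) = new_params g (map_params \<sigma> p)"
  by (cases g; cases p) (simp_all add: ratfun_hom_simps[OF assms])

lemma map_regular:
  assumes "ratfun_hom \<sigma>"
  shows "regular g (map_vars \<sigma> v) \<longleftrightarrow> regular g v"
proof -
  note h = ratfun_hom_simps[OF assms]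
  obtain x y z w t where v: "v = (x, y, z, w, t)" by (metis prod.collapse)
  show ?thesis
    using h(10)[of "t - 1"] h(10)[of "t - z"] h(10)[of "x * z - 1"] h(10)[of "z - 1"] h(10)[of "x - 1"]
    by (cases g) (simp_all add: v h del: right_minus_eq)
qed

lemma map_hamiltonian:
  assumes "ratfun_hom \<sigma>"
  shows "\<sigma> (hamiltonian p v) = hamiltonian (map_params \<sigma> p) (map_vars \<sigma> v)"
  by (cases p; cases v)
    (simp add: ratfun_hom_simps[OF assms] H_VI_def H_VI_tilde_def power2_eq_square)

section \<open>Phase space at fixed complex parameters\<close>

definition phase_assignment :: "'a vars \<Rightarrow> 5 \<Rightarrow> 'a" where
  "phase_assignment = (\<lambda>(x, y, z, w, t) i.
     if i = 0 then x else if i = 1 then y else if i = 2 then z else if i = 3 then w else t)"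

lemma phase_assignment_simps [simp]:
  "phase_assignment (x, y, z, w, t) 0 = x" "phase_assignment (x, y, z, w, t) 1 = y"
  "phase_assignment (x, y, z, w, t) 2 = z" "phase_assignment (x, y, z, w, t) 3 = w"
  "phase_assignment (x, y, z, w, t) 4 = t"
  by (simp_all add: phase_assignment_def)

lemma regular_phase_vars: "regular g phase_vars"
proof -
  \<comment> \<open>A point at which the denominators of all eight generators are nonzero at
    once.\<close>
  interpret evaluation id "phase_assignment (2, 1, 3, 1, 5 :: complex)"
    by (rule evaluation_id)
  have "vars_rel evals_to phase_vars (2, 1, 3, 1, 5)"
    using evals_to_var[of 0] evals_to_var[of 1] evals_to_var[of 2] evals_to_var[of 3] evals_to_var[of 4]
    by (simp add: phase_vars_def)
  then show ?thesis
    by (rule regular_if_evals_to) (cases g; simp)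
qed

lemma phase_nonzero:
  "var 0 \<noteq> (0 :: phase_field)" "var 1 \<noteq> (0 :: phase_field)" "var 2 \<noteq> (0 :: phase_field)"
  "var 3 \<noteq> (0 :: phase_field)" "var 4 \<noteq> (0 :: phase_field)" "var 4 - 1 \<noteq> (0 :: phase_field)"
  "var 4 - var 2 \<noteq> (0 :: phase_field)" "var 0 * var 2 - 1 \<noteq> (0 :: phase_field)"
  "var 2 - 1 \<noteq> (0 :: phase_field)" "var 0 - 1 \<noteq> (0 :: phase_field)"
  using regular_phase_vars[of S0] regular_phase_vars[of S1] regular_phase_vars[of S2] regular_phase_vars[of S3]
    regular_phase_vars[of S4] regular_phase_vars[of S5] regular_phase_vars[of S6] regular_phase_vars[of Phi]
  by (simp_all add: phase_vars_def)

text \<open>Only \<open>S0\<close> mixes \<open>t\<close> into the new \<open>x, y, z, w\<close>, so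
  its brackets are computed from this table. \<open>G\<close> is the shift of the Hamiltonian with
  its constant part left as \<open>b\<close>; its \<open>t\<close>-derivative never enters a
  bracket.\<close>

lemma S0_pderivs:
  fixes x y z w t X Y Z W G :: phase_field and a4 b :: complex
  defines "x \<equiv> var 0" and "y \<equiv> var 1" and "z \<equiv> var 2" and "w \<equiv> var 3" and "t \<equiv> var 4"
  defines "X \<equiv> (t * x - 1) / (t - 1)" and "Y \<equiv> (t - 1) * y / t" and "Z \<equiv> (t - 1) * z / (t - z)"
    and "W \<equiv> (t - z) * (t * w - z * w - const a4) / (t * (t - 1))"
    and "G \<equiv> ((1 - x) * y + z * (1 - z) * w - const a4 * z + const b) / (t * (t - 1))"
  shows "pderiv_rat 0 X = t / (t - 1)" "pderiv_rat 1 X = 0" "pderiv_rat 2 X = 0" "pderiv_rat 3 X = 0"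
      "pderiv_rat 4 X = (1 - x) / (t - 1)\<^sup>2"
    and "pderiv_rat 0 Y = 0" "pderiv_rat 1 Y = (t - 1) / t" "pderiv_rat 2 Y = 0" "pderiv_rat 3 Y = 0"
      "pderiv_rat 4 Y = y / t\<^sup>2"
    and "pderiv_rat 0 Z = 0" "pderiv_rat 1 Z = 0" "pderiv_rat 2 Z = t * (t - 1) / (t - z)\<^sup>2" "pderiv_rat 3 Z = 0"
      "pderiv_rat 4 Z = z * (1 - z) / (t - z)\<^sup>2"
    and "pderiv_rat 0 W = 0" "pderiv_rat 1 W = 0" "pderiv_rat 2 W = (const a4 - 2 * (t - z) * w) / (t * (t - 1))"
      "pderiv_rat 3 W = (t - z)\<^sup>2 / (t * (t - 1))"
      "pderiv_rat 4 W = ((2 * (t - z) * w - const a4) * (t * (t - 1)) -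
         (t - z) * ((t - z) * w - const a4) * (2 * t - 1)) / (t * (t - 1))\<^sup>2"
    and "pderiv_rat 0 G = - y / (t * (t - 1))" "pderiv_rat 1 G = (1 - x) / (t * (t - 1))"
      "pderiv_rat 2 G = ((1 - 2 * z) * w - const a4) / (t * (t - 1))"
      "pderiv_rat 3 G = z * (1 - z) / (t * (t - 1))"
proof -
  have nz: "t \<noteq> 0" "t - 1 \<noteq> 0" "t - z \<noteq> 0"
    using phase_nonzero unfolding t_def z_def by auto
  have D: "pderiv_rat 0 x = 1" "pderiv_rat 0 y = 0" "pderiv_rat 0 z = 0" "pderiv_rat 0 w = 0" "pderiv_rat 0 t = 0"
    "pderiv_rat 1 x = 0" "pderiv_rat 1 y = 1" "pderiv_rat 1 z = 0" "pderiv_rat 1 w = 0" "pderiv_rat 1 t = 0"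
    "pderiv_rat 2 x = 0" "pderiv_rat 2 y = 0" "pderiv_rat 2 z = 1" "pderiv_rat 2 w = 0" "pderiv_rat 2 t = 0"
    "pderiv_rat 3 x = 0" "pderiv_rat 3 y = 0" "pderiv_rat 3 z = 0" "pderiv_rat 3 w = 1" "pderiv_rat 3 t = 0"
    "pderiv_rat 4 x = 0" "pderiv_rat 4 y = 0" "pderiv_rat 4 z = 0" "pderiv_rat 4 w = 0" "pderiv_rat 4 t = 1"
    by (simp_all add: x_def y_def z_def w_def t_def pderiv_rat_var)
  note DX = X_def Y_def Z_def W_def G_def pderiv_rat_simps(1-9) D
  show "pderiv_rat 1 X = 0" "pderiv_rat 2 X = 0" "pderiv_rat 3 X = 0"
    "pderiv_rat 0 Y = 0" "pderiv_rat 2 Y = 0" "pderiv_rat 3 Y = 0"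
    "pderiv_rat 0 Z = 0" "pderiv_rat 1 Z = 0" "pderiv_rat 3 Z = 0" "pderiv_rat 0 W = 0" "pderiv_rat 1 W = 0"
    by (simp_all add: DX)
  show "pderiv_rat 0 X = t / (t - 1)" using nz by (simp add: DX)
  show "pderiv_rat 4 X = (1 - x) / (t - 1)\<^sup>2" using nz by (simp add: DX power2_eq_square algebra_simps)
  show "pderiv_rat 1 Y = (t - 1) / t" using nz by (simp add: DX)
  show "pderiv_rat 4 Y = y / t\<^sup>2" using nz by (simp add: DX power2_eq_square algebra_simps)
  show "pderiv_rat 2 Z = t * (t - 1) / (t - z)\<^sup>2" using nz by (simp add: DX power2_eq_square algebra_simps)
  show "pderiv_rat 4 Z = z * (1 - z) / (t - z)\<^sup>2" using nz by (simp add: DX power2_eq_square algebra_simps)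
  have sq: "(t * (t - 1)) \<noteq> 0" using nz by (simp del: right_minus_eq)
  have W: "pderiv_rat i W = (pderiv_rat i ((t - z) * (t * w - z * w - const a4)) * (t * (t - 1)) -
      (t - z) * (t * w - z * w - const a4) * pderiv_rat i (t * (t - 1))) / ((t * (t - 1)) * (t * (t - 1)))"
    and G: "pderiv_rat i G = (pderiv_rat i ((1 - x) * y + z * (1 - z) * w - const a4 * z + const b) * (t * (t - 1)) -
      ((1 - x) * y + z * (1 - z) * w - const a4 * z + const b) * pderiv_rat i (t * (t - 1))) /
      ((t * (t - 1)) * (t * (t - 1)))" for i
    unfolding W_def G_def by (rule pderiv_rat_simps(9))+
  have 0: "pderiv_rat 0 (t * (t - 1)) = 0" "pderiv_rat 1 (t * (t - 1)) = 0" "pderiv_rat 2 (t * (t - 1)) = 0"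
      "pderiv_rat 3 (t * (t - 1)) = 0" and 4: "pderiv_rat 4 (t * (t - 1)) = 2 * t - 1"
    by (simp_all add: pderiv_rat_simps(1-8) D)
  \<comment> \<open>The bracket differentiates in directions that annihilate
    \<open>t * (t - 1)\<close>, so the quotient rule acts on the numerator alone.\<close>
  have simple: "pderiv_rat i W = pderiv_rat i ((t - z) * (t * w - z * w - const a4)) / (t * (t - 1))"
    "pderiv_rat i G = pderiv_rat i ((1 - x) * y + z * (1 - z) * w - const a4 * z + const b) / (t * (t - 1))"
    if "pderiv_rat i (t * (t - 1)) = 0" for i
    unfolding W G that using sq by (simp_all del: mult_eq_0_iff)
  show "pderiv_rat 2 W = (const a4 - 2 * (t - z) * w) / (t * (t - 1))" "pderiv_rat 3 W = (t - z)\<^sup>2 / (t * (t - 1))"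
    "pderiv_rat 0 G = - y / (t * (t - 1))" "pderiv_rat 1 G = (1 - x) / (t * (t - 1))"
      "pderiv_rat 2 G = ((1 - 2 * z) * w - const a4) / (t * (t - 1))"
      "pderiv_rat 3 G = z * (1 - z) / (t * (t - 1))"
    unfolding simple[OF 0(1)] simple[OF 0(2)] simple[OF 0(3)] simple[OF 0(4)]
    by (rule arg_cong[where f = "\<lambda>u. u / (t * (t - 1))"],
        simp add: pderiv_rat_simps(1-8) D algebra_simps power2_eq_square)+
  show "pderiv_rat 4 W = ((2 * (t - z) * w - const a4) * (t * (t - 1)) -
         (t - z) * ((t - z) * w - const a4) * (2 * t - 1)) / (t * (t - 1))\<^sup>2"
    unfolding W 4 power2_eq_square
    by (rule arg_cong[where f = "\<lambda>u. u / (t * (t - 1) * (t * (t - 1)))"])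
      (simp add: pderiv_rat_simps(1-8) D algebra_simps)
qed

lemma map_new_params_const: "map_params const (new_params g a) = new_params g (map_params const a)"
  by (cases g; cases a) (simp_all add: const_add const_mult const_minus)

lemma normalized_const: "normalized a \<Longrightarrow> normalized (map_params const a)"
proof (cases a)
  case (fields a0 a1 a2 a3 a4 a5 a6)
  assume "normalized a"
  then have "const (2 * a0 + 2 * a1 + 2 * a2 + 2 * a3 + 2 * a4 + a5 + a6) = const 1"
    using fields by simp
  then show ?thesis using fields by (simp add: const_add const_mult del: one_eq_numeral_iff)
qed

text \<open>Supplies the rational inverse of the change of variables: the same formula at the
  transformed parameters.\<close>

lemma new_vars_inverse:
  assumes "regular g v"
  shows "new_vars g p (new_vars g (new_params g p) v) = v"
  using act_involution[OF assms, of "new_params g p"] by (simp add: new_params_involution)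

lemma phase_substitution:
  "\<exists>\<sigma>. field_aut \<sigma> \<and> map_vars \<sigma> phase_vars = new_vars g (map_params const a) phase_vars"
proof -
  have ev: "vars_rel (evaluation.evals_to const (phase_assignment
          (new_vars g (new_params g (map_params const b)) phase_vars)))
      (new_vars g (map_params const b) phase_vars) phase_vars" for b
  proof -
    let ?p = "map_params const b" and ?v' = "new_vars g (new_params g (map_params const b)) phase_vars"
    interpret evaluation const "phase_assignment ?v'" by (rule evaluation_const)
    have "vars_rel evals_to phase_vars ?v'"
      using evals_to_var[of 0] evals_to_var[of 1] evals_to_var[of 2] evals_to_var[of 3] evals_to_var[of 4]
      by (cases ?v') (simp add: phase_vars_def)
    moreover have "regular g ?v'"
      by (rule regular_new_vars[OF regular_phase_vars])
    ultimately show ?thesis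
      using evals_to_new_vars[OF evals_to_const_params, of phase_vars ?v' g b]
        new_vars_inverse[OF regular_phase_vars, of g ?p] by simp
  qed
  have rel: "R (phase_assignment v i) (var i)" if "vars_rel R v phase_vars" for R v and i :: 5
  proof -
    have "\<forall>i. R (phase_assignment v i) (var i)"
      using that unfolding forall_5 by (cases v) (simp add: phase_vars_def)
    then show ?thesis by blast
  qed
  let ?p = "map_params const a"
  \<comment> \<open>The two directions are \<open>ev\<close> at \<open>a\<close> and at
    \<open>new_params g a\<close>; the involution on parameters swaps the roles of the map and its
    inverse.\<close>
  have "\<exists>\<sigma>. field_aut \<sigma> \<and> (\<forall>i. \<sigma> (var i) = phase_assignment (new_vars g ?p phase_vars) i)"
    by (rule birational_field_aut[OF rel[OF ev[of a]]
          rel[OF ev[of "new_params g a", unfolded map_new_params_const new_params_involution]]])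
  then show ?thesis
    by (cases "new_vars g ?p phase_vars") (auto simp: phase_vars_def)
qed

lemma baecklund_new_vars: "baecklund (\<lambda>a. new_vars g (map_params const a) phase_vars) (new_params g)"
  unfolding baecklund_def
proof (intro allI impI conjI)
  fix a :: "complex params" assume a: "normalized a"
  then show "normalized (new_params g a)" by (rule normalized_new_params)
  let ?p = "map_params const a"
  obtain \<sigma> where \<sigma>: "field_aut \<sigma>" "map_vars \<sigma> phase_vars = new_vars g ?p phase_vars"
    using phase_substitution by blast
  have hom: "ratfun_hom \<sigma>" using \<sigma>(1) by (rule ratfun_hom_if_field_aut)
  obtain X Y Z W T where XYZW: "new_vars g ?p phase_vars = (X, Y, Z, W, T)"
    by (metis prod.collapse)
  define G where "G = hampoly_shift g ?p phase_vars / (var 4 * (var 4 - 1))"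
  obtain a0 a1 a2 a3 a4 a5 a6 where p: "a = (a0, a1, a2, a3, a4, a5, a6)"
    by (metis prod.collapse)
  note nz = phase_nonzero
  have m: "(1 - var 0) / (var 0 - 1) = (- 1 :: phase_field)"
    using nz(10) by (simp add: divide_eq_eq)
  have T: "T = var 4 \<and> orientation g = (1 :: phase_field) \<or> T = 1 - var 4 \<and> orientation g = (- 1 :: phase_field)"
    using XYZW by (cases g) (auto simp: p phase_vars_def orientation_def)
  have "map_params \<sigma> (map_params const b) = map_params const b" for b
    by (cases b) (simp add: ratfun_hom_simps[OF hom])
  from this[of "new_params g a"]
  have "\<sigma> (ham (new_params g a)) = hamiltonian (new_params g ?p) (new_vars g ?p phase_vars)"
    by (simp add: ham_def map_hamiltonian[OF hom] \<sigma>(2) map_new_params_const del: hamiltonian.simps)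
  then have H: "\<sigma> (ham (new_params g a)) = orientation g * (ham a + G)"
    using hamiltonian_new[of g "var 0 :: phase_field" "var 1" "var 2" "var 3" "var 4" ?p]
      regular_phase_vars[of g] normalized_const[OF a]
    by (simp add: ham_def G_def phase_vars_def del: hamiltonian.simps)
  have symp: "pbracket X Y = 1 \<and> pbracket X Z = 0 \<and> pbracket X W = 0 \<and> pbracket Y Z = 0 \<and>
     pbracket Y W = 0 \<and> pbracket Z W = 1"
  proof (cases "g = S0")
    case False
    then show ?thesis using XYZW
      by (cases g) (auto simp: p phase_vars_def pbracket_def pderiv_rat_simps nz nz[simplified] m)
  next
    case True
    have *: "X = (var 4 * var 0 - 1) / (var 4 - 1)" "Y = (var 4 - 1) * var 1 / var 4"
      "Z = (var 4 - 1) * var 2 / (var 4 - var 2)"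
      "W = (var 4 - var 2) * (var 4 * var 3 - var 2 * var 3 - const a4) / (var 4 * (var 4 - 1))"
      using XYZW True by (simp_all add: p phase_vars_def)
    show ?thesis
      unfolding pbracket_def * S0_pderivs using nz by (simp add: power2_eq_square del: right_minus_eq)
  qed
  have flow: "pbracket X G = pderiv_rat 4 X \<and> pbracket Y G = pderiv_rat 4 Y \<and>
     pbracket Z G = pderiv_rat 4 Z \<and> pbracket W G = pderiv_rat 4 W"
  proof (cases "g = S0")
    case False
    \<comment> \<open>Here \<open>G\<close> depends on \<open>t\<close> alone and the new
      \<open>x, y, z, w\<close> do not involve \<open>t\<close>, so both sides of each flow equation
      vanish.\<close>
    then have "pderiv_rat 0 G = 0" "pderiv_rat 1 G = 0" "pderiv_rat 2 G = 0" "pderiv_rat 3 G = 0"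
      unfolding G_def by (cases g; simp add: p phase_vars_def pderiv_rat_simps)+
    then show ?thesis using False XYZW
      by (cases g) (auto simp: p phase_vars_def pbracket_def pderiv_rat_simps)
  next
    case True
    let ?b = "- a2 * (a2 + a3 + a6) + a4 * a6"
    have *: "X = (var 4 * var 0 - 1) / (var 4 - 1)" "Y = (var 4 - 1) * var 1 / var 4"
      "Z = (var 4 - 1) * var 2 / (var 4 - var 2)"
      "W = (var 4 - var 2) * (var 4 * var 3 - var 2 * var 3 - const a4) / (var 4 * (var 4 - 1))"
      using XYZW True by (simp_all add: p phase_vars_def)
    have G: "G = ((1 - var 0) * var 1 + var 2 * (1 - var 2) * var 3 - const a4 * var 2 + const ?b) /
        (var 4 * (var 4 - 1))"
      by (simp add: G_def True p phase_vars_def const_add const_diff const_mult const_minus)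
    show ?thesis
      unfolding pbracket_def G * S0_pderivs using nz
      by (simp add: power2_eq_square divide_simps del: right_minus_eq) algebra
  qed
  show "\<exists>\<sigma>. field_aut \<sigma> \<and> map_vars \<sigma> phase_vars = new_vars g ?p phase_vars \<and>
        ddt a (\<sigma> (var 4)) \<noteq> 0 \<and>
        ddt a (\<sigma> (var 0)) / ddt a (\<sigma> (var 4)) = \<sigma> (pderiv_rat 1 (ham (new_params g a))) \<and>
        ddt a (\<sigma> (var 1)) / ddt a (\<sigma> (var 4)) = \<sigma> (- pderiv_rat 0 (ham (new_params g a))) \<and>
        ddt a (\<sigma> (var 2)) / ddt a (\<sigma> (var 4)) = \<sigma> (pderiv_rat 3 (ham (new_params g a))) \<and>
        ddt a (\<sigma> (var 3)) / ddt a (\<sigma> (var 4)) = \<sigma> (- pderiv_rat 2 (ham (new_params g a)))"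
    using \<sigma> baecklund_criterion[OF hom \<sigma>(2)[unfolded XYZW] _ _ _ _ _ _ T H] symp flow by blast
qed

section \<open>The group of substitutions\<close>

fun map_point :: "('a \<Rightarrow> 'b) \<Rightarrow> 'a params \<times> 'a vars \<Rightarrow> 'b params \<times> 'b vars" where
  "map_point f (p, v) = (map_params f p, map_vars f v)"

lemma map_act:
  assumes "ratfun_hom \<sigma>"
  shows "map_point \<sigma> (act g s) = act g (map_point \<sigma> s)"
  by (cases s) (simp add: map_new_vars[OF assms] map_new_params[OF assms])

lemma map_act_word:
  assumes "ratfun_hom \<sigma>"
  shows "map_point \<sigma> (act_word gs s) = act_word gs (map_point \<sigma> s)"
  by (induction gs arbitrary: s) (simp_all add: map_act[OF assms] del: act.simps)

text \<open>An injective homomorphism neither creates nor removes zeros among the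
  denominators.\<close>

lemma map_regular_word:
  assumes "ratfun_hom \<sigma>"
  shows "regular_word gs (map_point \<sigma> s) \<longleftrightarrow> regular_word gs s"
proof (induction gs arbitrary: s)
  case (Cons g gs)
  have "snd (map_point \<sigma> s) = map_vars \<sigma> (snd s)" by (cases s) simp
  then show ?case
    using Cons.IH[of "act g s"] by (simp add: map_regular[OF assms] map_act[OF assms] del: act.simps)
qed simp

section \<open>The generic point with indeterminate parameters\<close>

abbreviation full_point :: "full_field params \<times> full_field vars" where
  "full_point \<equiv> (full_params, full_vars)"

definition full_assignment :: "'a params \<times> 'a vars \<Rightarrow> 11 \<Rightarrow> 'a" where
  "full_assignment = (\<lambda>((a0, a1, a2, a3, a4, a5, a6), (x, y, z, w, t)) i.
     if i = 0 then x else if i = 1 then y else if i = 2 then z else if i = 3 then w else if i = 4 then t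
     else if i = 5 then a0 else if i = 6 then a1 else if i = 7 then a2 else if i = 8 then a3
     else if i = 9 then a4 else a5)"

lemma full_assignment_simps [simp]:
  fixes p :: "'a params" and v :: "'a vars"
  assumes "p = (a0, a1, a2, a3, a4, a5, a6)" "v = (x, y, z, w, t)"
  shows "full_assignment (p, v) 0 = x" "full_assignment (p, v) 1 = y" "full_assignment (p, v) 2 = z"
    "full_assignment (p, v) 3 = w" "full_assignment (p, v) 4 = t" "full_assignment (p, v) 5 = a0"
    "full_assignment (p, v) 6 = a1" "full_assignment (p, v) 7 = a2" "full_assignment (p, v) 8 = a3"
    "full_assignment (p, v) 9 = a4" "full_assignment (p, v) 10 = a5"
  by (simp_all add: full_assignment_def assms)

lemma forall_11: "(\<forall>i :: 11. P i) \<longleftrightarrow>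
  P 0 \<and> P 1 \<and> P 2 \<and> P 3 \<and> P 4 \<and> P 5 \<and> P 6 \<and> P 7 \<and> P 8 \<and> P 9 \<and> P 10"
proof (intro iffI allI)
  fix i :: 11
  assume P: "P 0 \<and> P 1 \<and> P 2 \<and> P 3 \<and> P 4 \<and> P 5 \<and> P 6 \<and> P 7 \<and> P 8 \<and> P 9 \<and> P 10"
  show "P i"
  proof (cases i)
    case (of_int z)
    then have "z \<in> {0, 1, 2, 3, 4, 5, 6, 7, 8, 9, 10}" by (simp; presburger)
    then show ?thesis using P of_int by auto
  qed
qed simp

lemma normalized_full_params: "normalized full_params"
  by (simp add: full_params_def)

text \<open>Every normalized point is a specialization of the generic one: the eleven indeterminates
  take any values, and the normalization then forces the last parameter.\<close>

lemma full_point_evals_to: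
  assumes "evaluation c" "normalized p"
  shows "params_rel (evaluation.evals_to c (full_assignment (p, v))) full_params p"
    "vars_rel (evaluation.evals_to c (full_assignment (p, v))) full_vars v"
proof -
  interpret evaluation c "full_assignment (p, v)" by (rule assms(1))
  obtain a0 a1 a2 a3 a4 a5 a6 x y z w t where p: "p = (a0, a1, a2, a3, a4, a5, a6)" and v: "v = (x, y, z, w, t)"
    by (metis prod.collapse)
  note s = full_assignment_simps[OF p v]
  note e = evals_to_var[of 0, unfolded s] evals_to_var[of 1, unfolded s] evals_to_var[of 2, unfolded s]
    evals_to_var[of 3, unfolded s] evals_to_var[of 4, unfolded s] evals_to_var[of 5, unfolded s]
    evals_to_var[of 6, unfolded s] evals_to_var[of 7, unfolded s] evals_to_var[of 8, unfolded s]
    evals_to_var[of 9, unfolded s] evals_to_var[of 10, unfolded s]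
  have "2 * a0 + 2 * a1 + 2 * a2 + 2 * a3 + 2 * a4 + a5 + a6 = 1"
    using assms(2) by (simp add: p)
  then have a6: "a6 = 1 - 2 * a0 - 2 * a1 - 2 * a2 - 2 * a3 - 2 * a4 - a5" by algebra
  have "evals_to (1 - 2 * var 5 - 2 * var 6 - 2 * var 7 - 2 * var 8 - 2 * var 9 - var 10) a6"
    unfolding a6 by (intro evals_to_diff evals_to_mult evals_to_1 evals_to_numeral e)
  then have "params_rel evals_to full_params (a0, a1, a2, a3, a4, a5, a6)" "vars_rel evals_to full_vars (x, y, z, w, t)"
    using e by (simp_all add: full_params_def full_vars_def)
  then show "params_rel evals_to full_params p" "vars_rel evals_to full_vars v"
    by (simp_all only: p v)
qed

lemma regular_full_vars: "regular g full_vars"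
proof -
  \<comment> \<open>Any normalized parameters would do, since the denominators involve only the
    variables.\<close>
  let ?p = "(0, 0, 0, 0, 0, 0, 1) :: complex params" and ?v = "(2, 1, 3, 1, 5) :: complex vars"
  interpret evaluation id "full_assignment (?p, ?v)" by (rule evaluation_id)
  have "vars_rel evals_to full_vars ?v"
    by (rule full_point_evals_to) (simp_all add: evaluation_id)
  then show ?thesis by (rule regular_if_evals_to) (cases g; simp)
qed

lemma full_substitution: "\<exists>\<sigma>. substitution_aut g \<sigma>"
proof -
  obtain p v where pv: "act g full_point = (p, v)" by (metis prod.collapse)
  then have p: "p = new_params g full_params" and v: "v = new_vars g full_params full_vars" by simp_all
  have n: "normalized p" unfolding p by (rule normalized_new_params[OF normalized_full_params])
  interpret evaluation const "full_assignment (p, v)" by (rule evaluation_const)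
  note e = full_point_evals_to[OF evaluation_const n, of v]
  have "vars_rel evals_to v full_vars"
    using evals_to_new_vars[OF e regular_new_vars[OF regular_full_vars, of g full_params, folded v]]
      act_involution[OF regular_full_vars, of g full_params] by (simp add: pv p v)
  moreover have "params_rel evals_to p full_params"
    using evals_to_new_params[OF e(1), of g] new_params_involution[of g full_params] by (simp add: p)
  ultimately have "\<forall>i. evals_to (full_assignment (p, v) i) (var i)"
    unfolding forall_11
    by (cases p; cases v) (simp add: full_params_def full_vars_def)
  \<comment> \<open>With the parameters among the indeterminates the substitution is its own
    inverse, so one evaluation fact provides both hypotheses of
    \<open>birational_field_aut\<close>.\<close>
  then obtain \<sigma> where \<sigma>: "field_aut \<sigma>" "\<And>i. \<sigma> (var i) = full_assignment (p, v) i"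
    using birational_field_aut by metis
  have hom: "ratfun_hom \<sigma>" using \<sigma>(1) by (rule ratfun_hom_if_field_aut)
  obtain a0 a1 a2 a3 a4 a5 a6 x y z w t where pe: "p = (a0, a1, a2, a3, a4, a5, a6)" and ve: "v = (x, y, z, w, t)"
    by (metis prod.collapse)
  have "2 * a0 + 2 * a1 + 2 * a2 + 2 * a3 + 2 * a4 + a5 + a6 = 1"
    using n by (simp add: pe)
  then have a6: "a6 = 1 - 2 * a0 - 2 * a1 - 2 * a2 - 2 * a3 - 2 * a4 - a5" by algebra
  have "map_params \<sigma> full_params = p" "map_vars \<sigma> full_vars = v"
    unfolding pe ve a6
    by (simp_all add: full_params_def full_vars_def \<sigma>(2) full_assignment_simps[OF pe ve] ratfun_hom_simps[OF hom])
  then have "substitution_aut g \<sigma>"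
    using \<sigma>(1) unfolding substitution_aut_def p v by blast
  then show ?thesis by blast
qed

lemma full_hom_eqI:
  assumes "ratfun_hom \<sigma>" "ratfun_hom \<tau>" "map_point \<sigma> full_point = map_point \<tau> full_point"
  shows "\<sigma> = \<tau>"
proof (rule ratfun_hom_eqI[OF assms(1,2)])
  fix i :: 11
  have "\<forall>i. \<sigma> (var i) = \<tau> (var i)"
    using assms(3) unfolding forall_11 by (simp add: full_params_def full_vars_def)
  then show "\<sigma> (var i) = \<tau> (var i)" ..
qed

section \<open>Automorphisms attached to words, and their relations\<close>

definition substitution :: "gen \<Rightarrow> full_field \<Rightarrow> full_field" where
  "substitution g = (SOME \<sigma>. substitution_aut g \<sigma>)"

lemma substitution_aut_substitution: "substitution_aut g (substitution g)"
  unfolding substitution_def using full_substitution by (rule someI_ex)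

lemma hom_substitution: "ratfun_hom (substitution g)"
  using substitution_aut_substitution unfolding substitution_aut_def by (blast intro: ratfun_hom_if_field_aut)

lemma map_substitution: "map_point (substitution g) full_point = act g full_point"
  using substitution_aut_substitution[of g] by (simp add: substitution_aut_def)

fun substitution_word :: "gen list \<Rightarrow> full_field \<Rightarrow> full_field" where
  "substitution_word [] = id"
| "substitution_word (g # gs) = substitution g \<circ> substitution_word gs"

lemma hom_substitution_word: "ratfun_hom (substitution_word gs)"
proof (induction gs)
  case (Cons g gs)
  then show ?case using hom_substitution[of g] by (simp add: ratfun_hom_def)
qed (simp add: ratfun_hom_def)

lemma map_point_comp: "map_point (f \<circ> g) s = map_point f (map_point g s)"
  by (cases s) (auto split: prod.split)

text \<open>The order of the letters agrees although \<open>act_word\<close> applies the head first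
  and composition of functions applies it last: a substitution commutes with the formulas, so it can
  be moved past the remaining word to the generic point.\<close>

lemma map_substitution_word: "map_point (substitution_word gs) full_point = act_word gs full_point"
proof (induction gs)
  case Nil
  show ?case by (simp add: full_params_def full_vars_def)
next
  case (Cons g gs)
  then show ?case
    by (simp only: substitution_word.simps act_word.simps map_point_comp
        map_act_word[OF hom_substitution] map_substitution)
qed

lemma substitution_word_eqI:
  "act_word gs full_point = act_word hs full_point \<Longrightarrow> substitution_word gs = substitution_word hs"
  by (intro full_hom_eqI hom_substitution_word) (simp only: map_substitution_word)

text \<open>As \<open>act g full_point\<close> is the image of \<open>full_point\<close> under the
  injective \<open>substitution g\<close>, a word is regular at one exactly when it is at the other.
  No intermediate denominator has to be computed.\<close>

lemma regular_word_full_point: "regular_word gs full_point"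
proof (induction gs)
  case (Cons g gs)
  then show ?case
    by (simp only: regular_word.simps snd_conv regular_full_vars simp_thms
        map_regular_word[OF hom_substitution] flip: map_substitution)
qed simp

lemma substitution_involution: "substitution g \<circ> substitution g = id"
proof -
  have "substitution_word [g, g] = substitution_word []"
    by (rule substitution_word_eqI) (simp add: act_involution regular_full_vars del: act.simps)
  then show ?thesis by simp
qed

text \<open>Converts equality of alternating words back into the power form by cancelling
  involutions.\<close>

lemma coxeter_power:
  assumes "\<And>x. f (f x) = x" "\<And>x. g (g x) = x"
  shows "(\<And>x. f (g x) = g (f x)) \<Longrightarrow> (f \<circ> g) ^^ 2 = id"
    "(\<And>x. f (g (f x)) = g (f (g x))) \<Longrightarrow> (f \<circ> g) ^^ 3 = id"
    "(\<And>x. f (g (f (g x))) = g (f (g (f x)))) \<Longrightarrow> (f \<circ> g) ^^ 4 = id"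
  using assms by (simp_all add: fun_eq_iff eval_nat_numeral)

lemma substitution_coxeter:
  assumes "i \<in> reflections" "j \<in> reflections" "i \<noteq> j"
  shows "(substitution i \<circ> substitution j) ^^ coxeter_B6 i j = id"
proof -
  have w: "substitution_word (alternating (coxeter_B6 i j) i j) = substitution_word (alternating (coxeter_B6 i j) j i)"
    by (rule substitution_word_eqI[OF coxeter_act[OF assms regular_word_full_point]])
  have inv: "substitution g (substitution g f) = f" for g f
    using substitution_involution[of g] by (simp add: fun_eq_iff)
  have "coxeter_B6 i j \<in> {2, 3, 4}" by (simp add: coxeter_B6_def)
  then show ?thesis
    using w coxeter_power[of "substitution i" "substitution j", OF inv inv] by (auto simp: eval_nat_numeral fun_eq_iff)
qed

lemma substitution_Phi:
  assumes "i \<in> reflections"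
  shows "substitution Phi \<circ> substitution i \<circ> inv (substitution Phi) = substitution (diagram_aut i)"
proof -
  have "substitution_word [Phi, i] = substitution_word [diagram_aut i, Phi]"
    using act_Phi[OF assms regular_word_full_point regular_word_full_point]
    by (intro substitution_word_eqI) (simp del: act.simps)
  then have "substitution Phi \<circ> substitution i = substitution (diagram_aut i) \<circ> substitution Phi"
    by simp
  moreover have "inv (substitution Phi) = substitution Phi"
    by (rule inv_unique_comp) (rule substitution_involution)+
  ultimately show ?thesis
    by (simp add: comp_assoc substitution_involution)
qed

theorem theorem3p1:
  shows "(\<forall>g. baecklund (\<lambda>a. new_vars g (map_params const a) phase_vars) (new_params g)) \<and>
    (\<exists>\<Sigma> :: gen \<Rightarrow> full_field \<Rightarrow> full_field.
       (\<forall>g. substitution_aut g (\<Sigma> g)) \<and>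
       (\<forall>i\<in>reflections. \<Sigma> i \<circ> \<Sigma> i = id) \<and>
       (\<forall>i\<in>reflections. \<forall>j\<in>reflections. i \<noteq> j \<longrightarrow> (\<Sigma> i \<circ> \<Sigma> j) ^^ coxeter_B6 i j = id) \<and>
       \<Sigma> Phi \<circ> \<Sigma> Phi = id \<and>
       (\<forall>i\<in>reflections. \<Sigma> Phi \<circ> \<Sigma> i \<circ> inv (\<Sigma> Phi) = \<Sigma> (diagram_aut i)))"
  using baecklund_new_vars substitution_aut_substitution substitution_involution substitution_coxeter
    substitution_Phi by blast

end
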